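(* Let $\gamma$ be a Borel probability measure on $\mathbb{R}$ lying in $\mathcal{T}_2$, i.e. such that there is $C<\infty$ with $\log\int_{\mathbb{R}}e^{ty}\gamma(dy)<C|t|^2+C$ for all $t\in\mathbb{R}$. For each $n$ let $X^{(n,\gamma)}\sim\gamma^{\otimes n}$, let $\Theta^{(n)}$ be independent of $X^{(n,\gamma)}$ and distributed according to the rotationally invariant probability measure on the unit sphere of $\mathbb{R}^n$, and set $W^{(n,\gamma)}:=n^{-1/2}\sum_{i=1}^nX^{(n,\gamma)}_i\Theta^{(n)}_i$. Then $(W^{(n,\gamma)})_{n\in\mathbb{N}}$ satisfies a large deviation principle (with speed $n$) with the quasiconvex good rate function $$\mathbb{I}^{\mathsf{an}}_\gamma(w):=\inf\{\Phi_\gamma^*(\tau_0,\tau_1):\tau_0>0,\ \tau_1\in\mathbb{R},\ \tau_0^{-1/2}\tau_1=w\},\quad w\in\mathbb{R},$$ where $\Phi_\gamma(t_0,t_1):=\log\int_{\mathbb{R}}\int_{\mathbb{R}}e^{t_0z^2+t_1zx}\,\mu_2(dz)\,\gamma(dx)$, $t_0,t_1\in\mathbb{R}$, and $\mu_2$ is the standard Gaussian measure.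
   Context: Legendre transform: $\Lambda^*(\tau)=\sup_{t}\{\langle t,\tau\rangle-\Lambda(t)\}$. Large deviation principle (LDP): a sequence $(\xi_n)$ of random variables in a topological space $\Sigma$ satisfies an LDP with speed $s(n)$ and rate function $I:\Sigma\to[0,\infty]$ if $I$ is lower semi-continuous and for all Borel $\Gamma\subset\Sigma$, $-\inf_{\Gamma^\circ}I\le\liminf_n\frac{1}{s(n)}\log\mathbb{P}(\xi_n\in\Gamma^\circ)\le\limsup_n\frac1{s(n)}\log\mathbb{P}(\xi_n\in\bar\Gamma)\le-\inf_{\bar\Gamma}I$. $I$ is good if its level sets $\{I\le c\}$ are compact. A function $f:\mathbb{R}\to(-\infty,\infty]$ is quasiconvex if $\{f\le c\}$ is convex for all $c\in\mathbb{R}$. *)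

theory Defs
  imports "HOL-Probability.Probability"
begin

definition log_ennreal :: "ennreal \<Rightarrow> ereal" where
  "log_ennreal x = (if x = 0 then -\<infinity> else if x = \<infinity> then \<infinity> else ereal (ln (enn2real x)))"

text \<open>Intended for \<open>\<Lambda>\<close> with values in \<open>(-\<infinity>, \<infinity>]\<close>; points with \<open>\<Lambda> t = \<infinity>\<close> contribute \<open>-\<infinity>\<close>
  to the supremum.\<close>

definition legendre :: "('v::real_inner \<Rightarrow> ereal) \<Rightarrow> 'v \<Rightarrow> ereal" where
  "legendre \<Lambda> \<tau> = (SUP t. ereal (t \<bullet> \<tau>) - \<Lambda> t)"

definition lower_semicontinuous :: "('b::topological_space \<Rightarrow> ereal) \<Rightarrow> bool" where
  "lower_semicontinuous f \<longleftrightarrow> (\<forall>c::real. closed {x. f x \<le> ereal c})"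

text \<open>The variables \<open>\<xi> n\<close> may live on different probability spaces \<open>M n\<close>. Sequences are indexed by
  \<open>n \<ge> 1\<close>; nothing is required of the index 0. The infimum over the empty set is \<open>\<infinity>\<close>.\<close>

definition satisfies_LDP ::
  "(nat \<Rightarrow> 'a measure) \<Rightarrow> (nat \<Rightarrow> 'a \<Rightarrow> 'b::topological_space) \<Rightarrow> (nat \<Rightarrow> real) \<Rightarrow> ('b \<Rightarrow> ereal) \<Rightarrow> bool"
where
  "satisfies_LDP M \<xi> s I \<longleftrightarrow>
     (\<forall>n\<ge>1. prob_space (M n) \<and> \<xi> n \<in> borel_measurable (M n)) \<and>
     (\<forall>x. 0 \<le> I x) \<and> lower_semicontinuous I \<and>
     (\<forall>\<Gamma>\<in>sets borel.
        - (INF x\<in>interior \<Gamma>. I x) \<le>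
          liminf (\<lambda>n. ereal (1 / s n) *
            log_ennreal (emeasure (M n) {\<omega> \<in> space (M n). \<xi> n \<omega> \<in> interior \<Gamma>})) \<and>
        liminf (\<lambda>n. ereal (1 / s n) *
            log_ennreal (emeasure (M n) {\<omega> \<in> space (M n). \<xi> n \<omega> \<in> interior \<Gamma>})) \<le>
          limsup (\<lambda>n. ereal (1 / s n) *
            log_ennreal (emeasure (M n) {\<omega> \<in> space (M n). \<xi> n \<omega> \<in> closure \<Gamma>})) \<and>
        limsup (\<lambda>n. ereal (1 / s n) *
            log_ennreal (emeasure (M n) {\<omega> \<in> space (M n). \<xi> n \<omega> \<in> closure \<Gamma>})) \<le>
          - (INF x\<in>closure \<Gamma>. I x))"

definition good_rate :: "('b::topological_space \<Rightarrow> ereal) \<Rightarrow> bool" where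
  "good_rate I \<longleftrightarrow> (\<forall>c::real. compact {x. I x \<le> ereal c})"

definition quasiconvex :: "(real \<Rightarrow> ereal) \<Rightarrow> bool" where
  "quasiconvex f \<longleftrightarrow> (\<forall>x. f x \<noteq> -\<infinity>) \<and> (\<forall>c::real. convex {x. f x \<le> ereal c})"

definition class_T2 :: "real measure \<Rightarrow> bool" where
  "class_T2 \<gamma> \<longleftrightarrow>
     (\<exists>C::real. \<forall>t::real. log_ennreal (\<integral>\<^sup>+ y. ennreal (exp (t * y)) \<partial>\<gamma>) < ereal (C * \<bar>t\<bar>\<^sup>2 + C))"

text \<open>Vectors of \<open>\<real>\<^sup>n\<close> are extensional functions on \<open>{1..n}\<close>, the points of the product space
  \<open>\<Pi>\<^sub>M i\<in>{1..n}. borel\<close>.\<close>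

abbreviation Rn :: "nat \<Rightarrow> (nat \<Rightarrow> real) measure" where
  "Rn n \<equiv> (\<Pi>\<^sub>M i\<in>{1..n}. (borel :: real measure))"

definition unit_sphere :: "nat \<Rightarrow> (nat \<Rightarrow> real) set" where
  "unit_sphere n = {x \<in> space (Rn n). (\<Sum>i=1..n. (x i)\<^sup>2) = 1}"

definition orthogonal_coeffs :: "nat \<Rightarrow> (nat \<Rightarrow> nat \<Rightarrow> real) \<Rightarrow> bool" where
  "orthogonal_coeffs n A \<longleftrightarrow>
     (\<forall>i\<in>{1..n}. \<forall>j\<in>{1..n}. (\<Sum>k=1..n. A k i * A k j) = (if i = j then 1 else 0))"

definition apply_coeffs :: "nat \<Rightarrow> (nat \<Rightarrow> nat \<Rightarrow> real) \<Rightarrow> (nat \<Rightarrow> real) \<Rightarrow> (nat \<Rightarrow> real)" where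
  "apply_coeffs n A x = (\<lambda>i\<in>{1..n}. \<Sum>j=1..n. A i j * x j)"

text \<open>The unique Borel probability measure carried by the unit sphere of \<open>\<real>\<^sup>n\<close>, \<open>n \<ge> 1\<close>, that is
  invariant under the orthogonal group. Using the full orthogonal group rather than only
  determinant 1 matters solely for \<open>n = 1\<close>, where it makes the measure uniform on \<open>{-1, 1}\<close>.\<close>

definition uniform_on_sphere :: "nat \<Rightarrow> (nat \<Rightarrow> real) measure \<Rightarrow> bool" where
  "uniform_on_sphere n \<sigma> \<longleftrightarrow>
     prob_space \<sigma> \<and> sets \<sigma> = sets (Rn n) \<and> emeasure \<sigma> (unit_sphere n) = 1 \<and>
     (\<forall>A. orthogonal_coeffs n A \<longrightarrow> distr \<sigma> (Rn n) (apply_coeffs n A) = \<sigma>)"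

definition \<Phi> :: "real measure \<Rightarrow> real \<times> real \<Rightarrow> ereal" where
  "\<Phi> \<gamma> = (\<lambda>(t0, t1). log_ennreal
     (\<integral>\<^sup>+ x. (\<integral>\<^sup>+ z. ennreal (exp (t0 * z\<^sup>2 + t1 * z * x)) \<partial>std_normal_distribution) \<partial>\<gamma>))"

definition I_an :: "real measure \<Rightarrow> real \<Rightarrow> ereal" where
  "I_an \<gamma> w = Inf {legendre (\<Phi> \<gamma>) (\<tau>0, \<tau>1) | \<tau>0 \<tau>1. \<tau>0 > 0 \<and> \<tau>0 powr (-1/2) * \<tau>1 = w}"

end

theory Submission
  imports Defs "HOL-Real_Asymp.Real_Asymp"
begin

text \<open>Let \<open>g\<close> be a standard Gaussian vector independent of \<open>(X, \<Theta>)\<close>. By rotational invariance of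
  \<open>\<Theta>\<close> the pair \<open>(\<bar>g\<bar>\<^sup>2, \<bar>g\<bar> \<langle>X, \<Theta>\<rangle>)\<close> has the moment generating function \<open>exp (n \<Phi>)\<close> of a sum of
  \<open>n\<close> independent copies of \<open>(z\<^sup>2, z x)\<close>, and \<open>W\<close> is the quotient of \<open>\<bar>g\<bar> \<langle>X, \<Theta>\<rangle> / n\<close> by
  \<open>\<bar>g\<bar> / \<surd>n\<close>. A rescaling of \<open>t\<close> shows that the infimum in \<open>I_an w\<close> is attained at \<open>\<tau>\<^sub>0 = 1\<close>, that
  is, \<open>I_an w = \<Phi>\<^sup>* (1, w)\<close>, which is an even convex function; goodness follows from finiteness of
  \<open>\<Phi>\<close> near the origin. The upper bound is Chernoff's bound on the event \<open>\<bar>g\<bar>\<^sup>2 / n \<approx> 1\<close>, which is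
  independent of \<open>W\<close>. For the lower bound the coordinates of \<open>X\<close> are truncated at level \<open>m\<close>; the
  truncated dual problem has a maximiser, exponential tilting by it concentrates the pair at
  \<open>(1, w)\<close>, and a compactness argument removes the truncation.\<close>

subsection \<open>Gaussian and spherical integrals\<close>

text \<open>The coordinates of \<open>\<Theta>\<close> are dependent, so \<open>W\<close> is not a
  mean of independent terms. The Gaussian radius restores a product structure exactly, for every n,
  but must be divided out afterwards. This is free on the exponential scale: the event that the
  normalised squared radius is near 1 has probability at least \<open>exp (- n \<eta>)\<close> and
  is independent of \<open>W\<close>. The lower bound is the obstacle. \<open>\<Phi>\<close> may
  become infinite inside \<open>t0 < 1/2\<close>, and then the supremum defining the dual value at
  \<open>(1, w)\<close> need not be attained at a point of differentiability, so no tilt with mean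
  \<open>(1, w)\<close> is guaranteed. Truncation makes the logarithmic generating function finite
  and smooth on the whole half-plane. A maximiser exists once the window holds mass of
  \<open>\<gamma>\<close> beyond \<open>|w|\<close>: the Gaussian factor is a barrier at
  \<open>t0 = 1/2\<close>, and that mass forces growth in \<open>t1\<close>. The truncated law is
  not renormalised, since lost mass only lowers probabilities. If \<open>|x| <= |w|\<close> almost
  surely, either \<open>w = 0\<close>, which is solved explicitly, or the rate is infinite.\<close>

lemma nn_integral_gauss_quadratic:
  fixes a t :: real
  assumes "t < 1 / 2"
  shows "(\<integral>\<^sup>+ z. ennreal (exp (t * z\<^sup>2 + a * z)) \<partial>std_normal_distribution) =
    ennreal (exp (a\<^sup>2 / (2 * (1 - 2 * t))) / sqrt (1 - 2 * t))"
proof -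
  define u where "u = 1 - 2 * t"
  have u: "u > 0" using assms by (simp add: u_def)
  \<comment> \<open>Completing the square: the tilted Gaussian is a multiple of the normal density
    with mean \<open>a / u\<close> and variance \<open>1 / u\<close>.\<close>
  have sq: "t * z\<^sup>2 + a * z - z\<^sup>2 / 2 = a\<^sup>2 / (2 * u) - (z - a / u)\<^sup>2 / (2 * (1 / sqrt u)\<^sup>2)" for z
  proof -
    have "t = (1 - u) / 2" by (simp add: u_def)
    then show ?thesis using u by (simp only:) (simp add: field_simps power2_eq_square)
  qed
  have eq: "std_normal_density z * exp (t * z\<^sup>2 + a * z) =
      (exp (a\<^sup>2 / (2 * u)) / sqrt u) * normal_density (a / u) (1 / sqrt u) z" for z
  proof -
    have "std_normal_density z * exp (t * z\<^sup>2 + a * z)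
        = 1 / sqrt (2 * pi) * exp (t * z\<^sup>2 + a * z - z\<^sup>2 / 2)"
      by (simp add: std_normal_density_def exp_add[symmetric] algebra_simps)
    also have "\<dots> = (exp (a\<^sup>2 / (2 * u)) / sqrt u) * normal_density (a / u) (1 / sqrt u) z"
      unfolding sq normal_density_def exp_diff using u
      by (simp add: real_sqrt_mult real_sqrt_divide exp_minus field_simps)
    finally show ?thesis .
  qed
  interpret N: prob_space "density lborel (normal_density (a / u) (1 / sqrt u))"
    using u by (intro prob_space_normal_density) simp
  have one: "(\<integral>\<^sup>+ z. ennreal (normal_density (a / u) (1 / sqrt u) z) \<partial>lborel) = 1"
    using N.emeasure_space_1 by (simp add: emeasure_density)
  have "(\<integral>\<^sup>+ z. ennreal (exp (t * z\<^sup>2 + a * z)) \<partial>std_normal_distribution) =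
      (\<integral>\<^sup>+ z. ennreal (std_normal_density z * exp (t * z\<^sup>2 + a * z)) \<partial>lborel)"
    by (subst nn_integral_density) (auto simp: ennreal_mult)
  also have "\<dots> = (\<integral>\<^sup>+ z. ennreal (exp (a\<^sup>2 / (2 * u)) / sqrt u) * ennreal (normal_density (a / u) (1 / sqrt u) z) \<partial>lborel)"
    unfolding eq using u by (intro nn_integral_cong ennreal_mult) auto
  also have "\<dots> = ennreal (exp (a\<^sup>2 / (2 * u)) / sqrt u)"
    by (subst nn_integral_cmult) (auto simp: one)
  finally show ?thesis by (simp add: u_def)
qed

text \<open>For \<open>t >= 1/2\<close> the quadratic term cancels the Gaussian decay, so on the
  half-line where \<open>a * z >= 0\<close> the integrand stays above a positive constant, and that
  half-line has infinite length.\<close>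

lemma nn_integral_gauss_quadratic_infinite:
  fixes a t :: real
  assumes "t \<ge> 1 / 2"
  shows "(\<integral>\<^sup>+ z. ennreal (exp (t * z\<^sup>2 + a * z)) \<partial>std_normal_distribution) = \<infinity>"
proof -
  define H where "H = {z::real. a * z \<ge> 0}"
  have H: "H \<in> sets lborel" unfolding H_def by measurable
  have "(of_nat k :: ennreal) \<le> emeasure lborel H" for k
  proof -
    obtain l where "{l..l + real k} \<subseteq> H"
    proof (cases "a \<ge> 0")
      case True
      then have "{0..0 + real k} \<subseteq> H" by (auto simp: H_def)
      then show ?thesis by (rule that)
    next
      case False
      then have "{- real k..- real k + real k} \<subseteq> H"
        by (auto simp: H_def intro: mult_nonpos_nonpos)
      then show ?thesis by (rule that)
    qed
    then have "emeasure lborel {l..l + real k} \<le> emeasure lborel H"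
      using H by (intro emeasure_mono)
    then show ?thesis by (simp add: ennreal_of_nat_eq_real_of_nat)
  qed
  then have "emeasure lborel H = \<infinity>"
    using SUP_least[of UNIV "of_nat :: nat \<Rightarrow> ennreal"] ennreal_SUP_of_nat_eq_top by (simp add: top_unique)
  then have "\<infinity> = (\<integral>\<^sup>+ z. ennreal (1 / sqrt (2 * pi)) * indicator H z \<partial>lborel)"
    using H by (subst nn_integral_cmult_indicator) (auto simp: ennreal_mult_top)
  also have "\<dots> \<le> (\<integral>\<^sup>+ z. ennreal (std_normal_density z * exp (t * z\<^sup>2 + a * z)) \<partial>lborel)"
  proof (intro nn_integral_mono)
    fix z :: real
    show "ennreal (1 / sqrt (2 * pi)) * indicator H z \<le> ennreal (std_normal_density z * exp (t * z\<^sup>2 + a * z))"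
    proof (cases "z \<in> H")
      case True
      have "z\<^sup>2 / 2 \<le> t * z\<^sup>2" using assms mult_right_mono[of "1/2" t "z\<^sup>2"] by simp
      then have "0 \<le> - z\<^sup>2 / 2 + (t * z\<^sup>2 + a * z)" using True by (simp add: H_def)
      then have "1 \<le> exp (- z\<^sup>2 / 2 + (t * z\<^sup>2 + a * z))" by simp
      then show ?thesis using True
        by (simp add: std_normal_density_def exp_add[symmetric] divide_right_mono)
    qed simp
  qed
  also have "\<dots> = (\<integral>\<^sup>+ z. ennreal (exp (t * z\<^sup>2 + a * z)) \<partial>std_normal_distribution)"
    by (subst nn_integral_density) (auto simp: ennreal_mult)
  finally show ?thesis by (simp add: top_unique)
qed

text \<open>Vectors of equal norm are exchanged by an orthogonal map, which the invariance of
  \<open>\<sigma>\<close> absorbs. Hence the law of the inner product with a uniform direction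
  depends on the vector only through its norm.\<close>

lemma nn_integral_sphere_inner:
  fixes x y :: "nat \<Rightarrow> real"
  assumes \<sigma>: "uniform_on_sphere n \<sigma>"
    and eq: "(\<Sum>i=1..n. (x i)\<^sup>2) = (\<Sum>i=1..n. (y i)\<^sup>2)"
    and f: "f \<in> borel_measurable borel"
  shows "(\<integral>\<^sup>+ \<theta>. f (\<Sum>i=1..n. x i * \<theta> i) \<partial>\<sigma>) = (\<integral>\<^sup>+ \<theta>. f (\<Sum>i=1..n. y i * \<theta> i) \<partial>\<sigma>)"
proof (cases "\<forall>i\<in>{1..n}. x i = y i")
  \<comment> \<open>Here the normal vector of the reflection used below would vanish, hence the
    separate case.\<close>
  case True
  then show ?thesis by (intro nn_integral_cong arg_cong[where f=f] sum.cong) auto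
next
  case False
  have [measurable_cong]: "sets \<sigma> = sets (Rn n)"
    using \<sigma> by (simp add: uniform_on_sphere_def)
  define v where "v i = x i - y i" for i
  define q where "q = (\<Sum>i=1..n. (v i)\<^sup>2)"
  have q: "q \<noteq> 0" using False unfolding q_def v_def by (subst sum_nonneg_eq_0_iff) auto
  \<comment> \<open>the Householder reflection exchanging \<open>x\<close> and \<open>y\<close>\<close>
  define A where "A i j = (if i = j then 1 else 0) - 2 * v i * v j / q" for i j :: nat
  have "q = (\<Sum>i=1..n. (x i)\<^sup>2) + (\<Sum>i=1..n. (y i)\<^sup>2) - 2 * (\<Sum>i=1..n. x i * y i)"
    unfolding q_def v_def sum_distrib_left sum.distrib[symmetric] sum_subtractf[symmetric]
    by (intro sum.cong) (auto simp: power2_eq_square algebra_simps)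
  moreover have "(\<Sum>i=1..n. v i * x i) = (\<Sum>i=1..n. (x i)\<^sup>2) - (\<Sum>i=1..n. x i * y i)"
    unfolding v_def sum_subtractf[symmetric]
    by (intro sum.cong) (auto simp: power2_eq_square algebra_simps)
  \<comment> \<open>Equality of the norms enters only here; it is what makes the reflection along
    \<open>x - y\<close> send \<open>x\<close> to \<open>y\<close>.\<close>
  ultimately have vx: "(\<Sum>i=1..n. v i * x i) = q / 2" using eq by simp
  have delta: "(\<Sum>k=1..n. (if k = i then 1 else 0) * f k) = f i" if "i \<in> {1..n}" for i and f :: "nat \<Rightarrow> real"
    using that by (subst sum.cong[OF refl, of _ _ "\<lambda>k. if k = i then f k else 0"]) auto
  have orth: "orthogonal_coeffs n A"
    unfolding orthogonal_coeffs_def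
  proof (intro ballI)
    fix i j assume i: "i \<in> {1..n}" and j: "j \<in> {1..n}"
    have "(\<Sum>k=1..n. A k i * A k j) = (\<Sum>k=1..n. (if k = i then 1 else 0) * (if k = j then 1 else 0)
       - (if k = i then 1 else 0) * (2 * v k * v j / q) - (if k = j then 1 else 0) * (2 * v k * v i / q)
       + 4 * v i * v j / q\<^sup>2 * (v k)\<^sup>2)"
      using q by (intro sum.cong) (auto simp: A_def power2_eq_square field_simps)
    also have "\<dots> = (if i = j then 1 else 0) - 2 * v i * v j / q - 2 * v j * v i / q
       + 4 * v i * v j / q\<^sup>2 * q"
      unfolding sum.distrib sum_subtractf delta[OF i] delta[OF j] q_def sum_distrib_left[symmetric]
      by simp
    also have "\<dots> = (if i = j then 1 else 0)" using q by (simp add: power2_eq_square)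
    finally show "(\<Sum>k=1..n. A k i * A k j) = (if i = j then 1 else 0)" .
  qed
  have Ax: "(\<Sum>i=1..n. x i * A i j) = y j" if j: "j \<in> {1..n}" for j
  proof -
    have "(\<Sum>i=1..n. x i * A i j) = (\<Sum>i=1..n. (if i = j then 1 else 0) * x i - 2 * v j / q * (v i * x i))"
      by (intro sum.cong) (auto simp: A_def field_simps)
    also have "\<dots> = x j - 2 * v j / q * (q / 2)"
      unfolding sum_subtractf delta[OF j] sum_distrib_left[symmetric] vx by simp
    also have "\<dots> = y j" using q by (simp add: v_def field_simps)
    finally show ?thesis .
  qed
  have swap: "(\<Sum>i=1..n. x i * apply_coeffs n A \<theta> i) = (\<Sum>i=1..n. y i * \<theta> i)" for \<theta>
  proof -
    have "(\<Sum>i=1..n. x i * apply_coeffs n A \<theta> i) = (\<Sum>i=1..n. \<Sum>j=1..n. x i * A i j * \<theta> j)"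
      by (intro sum.cong) (auto simp: apply_coeffs_def sum_distrib_left mult.assoc)
    also have "\<dots> = (\<Sum>j=1..n. (\<Sum>i=1..n. x i * A i j) * \<theta> j)"
      by (subst sum.swap) (simp add: sum_distrib_right)
    also have "\<dots> = (\<Sum>i=1..n. y i * \<theta> i)" by (rule sum.cong[OF refl]) (simp only: Ax)
    finally show ?thesis .
  qed
  have [measurable]: "apply_coeffs n A \<in> measurable \<sigma> (Rn n)"
    unfolding apply_coeffs_def by measurable
  have "(\<integral>\<^sup>+ \<theta>. f (\<Sum>i=1..n. x i * \<theta> i) \<partial>\<sigma>) =
      (\<integral>\<^sup>+ \<theta>. f (\<Sum>i=1..n. x i * \<theta> i) \<partial>distr \<sigma> (Rn n) (apply_coeffs n A))"
    using \<sigma> orth by (simp add: uniform_on_sphere_def)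
  also have "\<dots> = (\<integral>\<^sup>+ \<theta>. f (\<Sum>i=1..n. x i * apply_coeffs n A \<theta> i) \<partial>\<sigma>)"
    by (rule nn_integral_distr) (use f in measurable)
  finally show ?thesis by (simp only: swap)
qed

section \<open>Joint moment generating function of the Gaussian radius and the rescaled
  projection\<close>

lemma prob_space_std_normal: "prob_space std_normal_distribution"
  using prob_space_normal_density[of 1 0] by simp

abbreviation gauss_vec :: "nat \<Rightarrow> (nat \<Rightarrow> real) measure" where
  "gauss_vec n \<equiv> \<Pi>\<^sub>M i\<in>{1..n}. std_normal_distribution"

lemma prob_space_gauss_vec: "prob_space (gauss_vec n)"
  by (intro prob_space_PiM prob_space_std_normal)

text \<open>One-coordinate generating function of \<open>(z^2, z x)\<close> with \<open>x\<close>
  confined to \<open>B\<close>, not renormalised. \<open>B = UNIV\<close> gives the exponential of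
  \<open>\<Phi>\<close>; bounded windows give its truncations. Values in \<open>ennreal\<close>
  accommodate divergence.\<close>

definition slice_mgf :: "real measure \<Rightarrow> real set \<Rightarrow> real \<Rightarrow> real \<Rightarrow> ennreal" where
  "slice_mgf \<gamma> B t0 t1 =
     (\<integral>\<^sup>+ x. indicator B x * (\<integral>\<^sup>+ z. ennreal (exp (t0 * z\<^sup>2 + t1 * z * x)) \<partial>std_normal_distribution) \<partial>\<gamma>)"

text \<open>For fixed \<open>x\<close> and \<open>g\<close> the vectors \<open>\<bar>g\<bar> x\<close> and \<open>\<bar>x\<bar> g\<close> have the same norm, so under the spherical
  integral one may be replaced by the other; this decouples the coordinates of \<open>g\<close>.\<close>

lemma nn_integral_sphere_gauss:
  fixes x :: "nat \<Rightarrow> real"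
  assumes \<sigma>: "uniform_on_sphere n \<sigma>" and t0: "t0 < 1 / 2"
  shows "(\<integral>\<^sup>+ \<theta>. \<integral>\<^sup>+ g. ennreal (exp (t0 * (\<Sum>i=1..n. (g i)\<^sup>2) +
        t1 * (sqrt (\<Sum>i=1..n. (g i)\<^sup>2) * (\<Sum>i=1..n. x i * \<theta> i)))) \<partial>gauss_vec n \<partial>\<sigma>) =
      (\<Prod>i=1..n. \<integral>\<^sup>+ z. ennreal (exp (t0 * z\<^sup>2 + t1 * z * x i)) \<partial>std_normal_distribution)"
proof -
  have [measurable_cong]: "sets \<sigma> = sets (Rn n)"
    using \<sigma> by (simp add: uniform_on_sphere_def)
  have [measurable_cong]: "sets (gauss_vec n) = sets (Rn n)"
    by (intro sets_PiM_cong) auto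
  interpret S: prob_space \<sigma> using \<sigma> by (simp add: uniform_on_sphere_def)
  interpret G: prob_space "gauss_vec n" by (rule prob_space_gauss_vec)
  interpret P: pair_sigma_finite \<sigma> "gauss_vec n" ..
  interpret Z: prob_space std_normal_distribution by (rule prob_space_std_normal)
  interpret Q: product_sigma_finite "\<lambda>_::nat. std_normal_distribution" ..
  define u where "u = 1 - 2 * t0"
  have u: "u > 0" using t0 by (simp add: u_def)
  define r where "r y = sqrt (\<Sum>i=1..n. (y i)\<^sup>2)" for y :: "nat \<Rightarrow> real"
  have r2: "(r y)\<^sup>2 = (\<Sum>i=1..n. (y i)\<^sup>2)" for y
    unfolding r_def by (rule real_sqrt_pow2) (simp add: sum_nonneg)
  have [measurable]: "r \<in> borel_measurable (Rn n)" unfolding r_def by measurable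
  have "(\<integral>\<^sup>+ \<theta>. \<integral>\<^sup>+ g. ennreal (exp (t0 * (r g)\<^sup>2 + t1 * (r g * (\<Sum>i=1..n. x i * \<theta> i)))) \<partial>gauss_vec n \<partial>\<sigma>)
      = (\<integral>\<^sup>+ g. \<integral>\<^sup>+ \<theta>. ennreal (exp (t0 * (r g)\<^sup>2 + t1 * (r g * (\<Sum>i=1..n. x i * \<theta> i)))) \<partial>\<sigma> \<partial>gauss_vec n)"
    by (rule P.Fubini'[symmetric]) measurable
  also have "\<dots> = (\<integral>\<^sup>+ g. \<integral>\<^sup>+ \<theta>. ennreal (exp (t0 * (r g)\<^sup>2 + t1 * (\<Sum>i=1..n. (r g * x i) * \<theta> i))) \<partial>\<sigma> \<partial>gauss_vec n)"
    by (simp add: sum_distrib_left mult.assoc)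
  also have "\<dots> = (\<integral>\<^sup>+ g. \<integral>\<^sup>+ \<theta>. ennreal (exp (t0 * (r g)\<^sup>2 + t1 * (\<Sum>i=1..n. (r x * g i) * \<theta> i))) \<partial>\<sigma> \<partial>gauss_vec n)"
  proof (rule nn_integral_cong)
    fix g
    have "(\<Sum>i=1..n. (r g * x i)\<^sup>2) = (\<Sum>i=1..n. (r x * g i)\<^sup>2)"
      unfolding power_mult_distrib sum_distrib_left[symmetric] r2 by simp
    then show "(\<integral>\<^sup>+ \<theta>. ennreal (exp (t0 * (r g)\<^sup>2 + t1 * (\<Sum>i=1..n. (r g * x i) * \<theta> i))) \<partial>\<sigma>) =
        (\<integral>\<^sup>+ \<theta>. ennreal (exp (t0 * (r g)\<^sup>2 + t1 * (\<Sum>i=1..n. (r x * g i) * \<theta> i))) \<partial>\<sigma>)"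
      by (rule nn_integral_sphere_inner[OF \<sigma>, where f = "\<lambda>y. ennreal (exp (t0 * (r g)\<^sup>2 + t1 * y))"]) measurable
  qed
  also have "\<dots> = (\<integral>\<^sup>+ \<theta>. \<integral>\<^sup>+ g. ennreal (exp (t0 * (r g)\<^sup>2 + t1 * (\<Sum>i=1..n. (r x * g i) * \<theta> i))) \<partial>gauss_vec n \<partial>\<sigma>)"
    by (rule P.Fubini') measurable
  also have "\<dots> = (\<integral>\<^sup>+ \<theta>. \<integral>\<^sup>+ g. (\<Prod>i=1..n. ennreal (exp (t0 * (g i)\<^sup>2 + (t1 * r x * \<theta> i) * g i))) \<partial>gauss_vec n \<partial>\<sigma>)"
    unfolding r2 by (simp add: prod_ennreal exp_sum[symmetric] sum.distrib sum_distrib_left ac_simps)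
  also have "\<dots> = (\<integral>\<^sup>+ \<theta>. (\<Prod>i=1..n. ennreal (exp ((t1 * r x * \<theta> i)\<^sup>2 / (2 * u)) / sqrt u)) \<partial>\<sigma>)"
  proof (rule nn_integral_cong)
    fix \<theta>
    have "(\<integral>\<^sup>+ g. (\<Prod>i=1..n. ennreal (exp (t0 * (g i)\<^sup>2 + (t1 * r x * \<theta> i) * g i))) \<partial>gauss_vec n)
        = (\<Prod>i=1..n. \<integral>\<^sup>+ z. ennreal (exp (t0 * z\<^sup>2 + (t1 * r x * \<theta> i) * z)) \<partial>std_normal_distribution)"
      by (rule Q.product_nn_integral_prod) (simp, measurable)
    then show "(\<integral>\<^sup>+ g. (\<Prod>i=1..n. ennreal (exp (t0 * (g i)\<^sup>2 + (t1 * r x * \<theta> i) * g i))) \<partial>gauss_vec n)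
        = (\<Prod>i=1..n. ennreal (exp ((t1 * r x * \<theta> i)\<^sup>2 / (2 * u)) / sqrt u))"
      by (simp only: nn_integral_gauss_quadratic[OF t0] u_def)
  qed
  \<comment> \<open>The exponents add up to a multiple of the squared norm of
    \<open>\<theta>\<close>, which is 1 almost surely; no dependence on \<open>\<theta>\<close>
    remains.\<close>
  also have "\<dots> = (\<integral>\<^sup>+ \<theta>. ennreal (exp (t1\<^sup>2 * (r x)\<^sup>2 / (2 * u)) / sqrt u ^ n) \<partial>\<sigma>)"
  proof (rule nn_integral_cong_AE)
    have "AE \<theta> in \<sigma>. \<theta> \<in> unit_sphere n"
      using \<sigma> by (intro S.AE_prob_1) (simp add: uniform_on_sphere_def S.emeasure_eq_measure)
    then show "AE \<theta> in \<sigma>. (\<Prod>i=1..n. ennreal (exp ((t1 * r x * \<theta> i)\<^sup>2 / (2 * u)) / sqrt u))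
        = ennreal (exp (t1\<^sup>2 * (r x)\<^sup>2 / (2 * u)) / sqrt u ^ n)"
    proof eventually_elim
      case (elim \<theta>)
      then have "(\<Sum>i=1..n. (t1 * r x * \<theta> i)\<^sup>2 / (2 * u)) = t1\<^sup>2 * (r x)\<^sup>2 / (2 * u)"
        by (simp add: unit_sphere_def power_mult_distrib sum_divide_distrib[symmetric] sum_distrib_left[symmetric])
      then show ?case using u
        by (simp add: prod_ennreal prod_dividef exp_sum[symmetric])
    qed
  qed
  also have "\<dots> = ennreal (exp (t1\<^sup>2 * (r x)\<^sup>2 / (2 * u)) / sqrt u ^ n)"
    by (simp add: S.emeasure_space_1)
  \<comment> \<open>The squared norm of \<open>x\<close> is split into coordinates again, so that
    each factor is once more a one-dimensional Gaussian integral, now with linear coefficient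
    \<open>t1 * x i\<close>.\<close>
  also have "\<dots> = (\<Prod>i=1..n. ennreal (exp ((t1 * x i)\<^sup>2 / (2 * u)) / sqrt u))"
  proof -
    have "(\<Sum>i=1..n. (t1 * x i)\<^sup>2 / (2 * u)) = t1\<^sup>2 * (r x)\<^sup>2 / (2 * u)"
      unfolding r2 by (simp add: power_mult_distrib sum_divide_distrib[symmetric] sum_distrib_left[symmetric])
    then show ?thesis using u
      by (simp add: prod_ennreal prod_dividef exp_sum[symmetric])
  qed
  also have "\<dots> = (\<Prod>i=1..n. \<integral>\<^sup>+ z. ennreal (exp (t0 * z\<^sup>2 + (t1 * x i) * z)) \<partial>std_normal_distribution)"
    by (simp add: nn_integral_gauss_quadratic[OF t0] u_def)
  finally show ?thesis unfolding r2 unfolding r_def by (simp add: ac_simps)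
qed

text \<open>The truncation factor does not depend on \<open>\<theta>\<close> or \<open>g\<close> and
  can be pulled out. What is left factorises over the coordinates of \<open>x\<close>, and the
  product law turns it into an n-th power.\<close>

lemma joint_mgf:
  assumes "prob_space \<gamma>" and sets_\<gamma>: "sets \<gamma> = sets borel" and B: "B \<in> sets borel"
    and \<sigma>: "uniform_on_sphere n \<sigma>" and t0: "t0 < 1 / 2"
  shows "(\<integral>\<^sup>+ x. \<integral>\<^sup>+ \<theta>. \<integral>\<^sup>+ g. (\<Prod>i=1..n. indicator B (x i)) * ennreal (exp (t0 * (\<Sum>i=1..n. (g i)\<^sup>2) +
        t1 * (sqrt (\<Sum>i=1..n. (g i)\<^sup>2) * (\<Sum>i=1..n. x i * \<theta> i)))) \<partial>gauss_vec n \<partial>\<sigma> \<partial>(\<Pi>\<^sub>M i\<in>{1..n}. \<gamma>)) =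
      slice_mgf \<gamma> B t0 t1 ^ n"
proof -
  note [measurable] = B
  note [measurable_cong] = sets_\<gamma>
  have [measurable_cong]: "sets \<sigma> = sets (Rn n)"
    using \<sigma> by (simp add: uniform_on_sphere_def)
  have [measurable_cong]: "sets (gauss_vec n) = sets (Rn n)"
    by (intro sets_PiM_cong) auto
  interpret S: prob_space \<sigma> using \<sigma> by (simp add: uniform_on_sphere_def)
  interpret G: prob_space "gauss_vec n" by (rule prob_space_gauss_vec)
  interpret Z: prob_space std_normal_distribution by (rule prob_space_std_normal)
  interpret gam: prob_space \<gamma> by fact
  interpret Q: product_sigma_finite "\<lambda>_::nat. \<gamma>" ..
  have "(\<integral>\<^sup>+ x. \<integral>\<^sup>+ \<theta>. \<integral>\<^sup>+ g. (\<Prod>i=1..n. indicator B (x i)) * ennreal (exp (t0 * (\<Sum>i=1..n. (g i)\<^sup>2) +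
        t1 * (sqrt (\<Sum>i=1..n. (g i)\<^sup>2) * (\<Sum>i=1..n. x i * \<theta> i)))) \<partial>gauss_vec n \<partial>\<sigma> \<partial>(\<Pi>\<^sub>M i\<in>{1..n}. \<gamma>)) =
      (\<integral>\<^sup>+ x. (\<Prod>i=1..n. indicator B (x i)) * (\<integral>\<^sup>+ \<theta>. \<integral>\<^sup>+ g. ennreal (exp (t0 * (\<Sum>i=1..n. (g i)\<^sup>2) +
        t1 * (sqrt (\<Sum>i=1..n. (g i)\<^sup>2) * (\<Sum>i=1..n. x i * \<theta> i)))) \<partial>gauss_vec n \<partial>\<sigma>) \<partial>(\<Pi>\<^sub>M i\<in>{1..n}. \<gamma>))"
    by (subst nn_integral_cmult, measurable)+
  also have "\<dots> = (\<integral>\<^sup>+ x. (\<Prod>i=1..n. indicator B (x i) *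
      (\<integral>\<^sup>+ z. ennreal (exp (t0 * z\<^sup>2 + t1 * z * x i)) \<partial>std_normal_distribution)) \<partial>(\<Pi>\<^sub>M i\<in>{1..n}. \<gamma>))"
    unfolding nn_integral_sphere_gauss[OF \<sigma> t0] prod.distrib ..
  also have "\<dots> = (\<Prod>i=1..n. slice_mgf \<gamma> B t0 t1)"
    unfolding slice_mgf_def by (rule Q.product_nn_integral_prod) (simp, measurable)
  finally show ?thesis by simp
qed

subsection \<open>Exponential tilting\<close>

text \<open>Chernoff's bound under the weight \<open>exp (n V)\<close>, of total mass
  \<open>exp (n \<psi> 0)\<close>. Since \<open>\<psi>\<close> has slope \<open>c\<close> at 0, a
  small \<open>h > 0\<close> gives \<open>\<psi> h <= \<psi> 0 + h (c + \<delta>/2)\<close>, and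
  exceeding \<open>c + \<delta>\<close> then costs the rate \<open>h \<delta> / 2\<close>.\<close>

lemma tilted_tail:
  fixes V Z :: "nat \<Rightarrow> 'b \<Rightarrow> real" and \<psi> :: "real \<Rightarrow> real"
  assumes meas: "\<And>n. n \<ge> 1 \<Longrightarrow> V n \<in> borel_measurable (Q n)" "\<And>n. n \<ge> 1 \<Longrightarrow> Z n \<in> borel_measurable (Q n)"
    and mgf: "\<And>n h. n \<ge> 1 \<Longrightarrow> \<bar>h\<bar> < \<epsilon> \<Longrightarrow>
      (\<integral>\<^sup>+ \<omega>. ennreal (exp (real n * (V n \<omega> + h * Z n \<omega>))) \<partial>Q n) = ennreal (exp (real n * \<psi> h))"
    and der: "(\<psi> has_real_derivative c) (at 0)"
    and pos: "\<epsilon> > 0" "\<delta> > 0"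
  shows "\<exists>\<kappa>>0. \<forall>n\<ge>1. (\<integral>\<^sup>+ \<omega>. indicator {\<omega>. c + \<delta> \<le> Z n \<omega>} \<omega> * ennreal (exp (real n * V n \<omega>)) \<partial>Q n)
    \<le> ennreal (exp (real n * (\<psi> 0 - \<kappa>)))"
proof -
  have "((\<lambda>h. (\<psi> h - \<psi> 0) / h) \<longlongrightarrow> c) (at 0)"
    using der by (simp add: DERIV_def)
  then have "\<forall>\<^sub>F h in at 0. (\<psi> h - \<psi> 0) / h < c + \<delta> / 2"
    using pos by (intro order_tendstoD) auto
  then obtain d where d: "d > 0" "\<And>h. h \<noteq> 0 \<Longrightarrow> dist h 0 < d \<Longrightarrow> (\<psi> h - \<psi> 0) / h < c + \<delta> / 2"
    unfolding eventually_at by auto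
  \<comment> \<open>Below \<open>d\<close> for the slope estimate, below \<open>\<epsilon>\<close>
    for the generating function identity; halving makes both strict.\<close>
  define h where "h = min d \<epsilon> / 2"
  have h: "h > 0" "h < \<epsilon>" "h < d" using d pos by (auto simp: h_def)
  have psi: "\<psi> h \<le> \<psi> 0 + h * (c + \<delta> / 2)"
    using d(2)[of h] h by (simp add: field_simps)
  have "(\<integral>\<^sup>+ \<omega>. indicator {\<omega>. c + \<delta> \<le> Z n \<omega>} \<omega> * ennreal (exp (real n * V n \<omega>)) \<partial>Q n)
    \<le> ennreal (exp (real n * (\<psi> 0 - h * \<delta> / 2)))" if n: "n \<ge> 1" for n
  proof -
    have "(\<integral>\<^sup>+ \<omega>. indicator {\<omega>. c + \<delta> \<le> Z n \<omega>} \<omega> * ennreal (exp (real n * V n \<omega>)) \<partial>Q n) \<le>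
      (\<integral>\<^sup>+ \<omega>. ennreal (exp (- real n * h * (c + \<delta>))) * ennreal (exp (real n * (V n \<omega> + h * Z n \<omega>))) \<partial>Q n)"
    proof (rule nn_integral_mono)
      fix \<omega>
      show "indicator {\<omega>. c + \<delta> \<le> Z n \<omega>} \<omega> * ennreal (exp (real n * V n \<omega>)) \<le>
          ennreal (exp (- real n * h * (c + \<delta>))) * ennreal (exp (real n * (V n \<omega> + h * Z n \<omega>)))"
      proof (cases "c + \<delta> \<le> Z n \<omega>")
        case True
        then have "real n * h * (c + \<delta>) \<le> real n * h * Z n \<omega>" using h by (intro mult_left_mono) auto
        then show ?thesis using True
          by (simp add: ennreal_mult[symmetric] exp_add[symmetric] algebra_simps)
      qed simp
    qed
    also have "\<dots> = ennreal (exp (- real n * h * (c + \<delta>))) * ennreal (exp (real n * \<psi> h))"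
      using meas[OF n] mgf[OF n, of h] h by (subst nn_integral_cmult) auto
    also have "\<dots> = ennreal (exp (real n * (\<psi> h - h * (c + \<delta>))))"
      by (simp add: ennreal_mult[symmetric] exp_add[symmetric] algebra_simps)
    also have "\<dots> \<le> ennreal (exp (real n * (\<psi> 0 - h * \<delta> / 2)))"
    proof -
      have "\<psi> h - h * (c + \<delta>) \<le> \<psi> 0 - h * \<delta> / 2" using psi by (simp add: algebra_simps)
      then show ?thesis by (intro ennreal_leI) (simp add: mult_left_mono)
    qed
    finally show ?thesis .
  qed
  moreover have "h * \<delta> / 2 > 0" using h pos by simp
  ultimately show ?thesis by blast
qed

lemma DERIV_shift_zero:
  fixes f :: "real \<Rightarrow> real"
  assumes "(f has_real_derivative a) (at x)"
  shows "((\<lambda>h. f (x + h)) has_real_derivative a) (at 0)"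
    and "((\<lambda>h. f (x - h)) has_real_derivative - a) (at 0)"
proof -
  have *: "((\<lambda>h. x + h) has_real_derivative 1) (at 0)" "((\<lambda>h. x - h) has_real_derivative - 1) (at 0)"
    by (auto intro!: derivative_eq_intros)
  show "((\<lambda>h. f (x + h)) has_real_derivative a) (at 0)"
    using DERIV_chain'[OF *(1), of f a] assms by simp
  show "((\<lambda>h. f (x - h)) has_real_derivative - a) (at 0)"
    using DERIV_chain'[OF *(2), of f a] assms by simp
qed

text \<open>The weight with parameters \<open>(t0, t1)\<close> has mass
  \<open>exp (n \<phi>)\<close> and, by \<open>tilted_tail\<close> in the four coordinate
  directions, sits near the gradient \<open>(a, b)\<close>. The weight is almost constant there, so
  dividing by it bounds the untilted mass of the box. \<open>Q n\<close> is an arbitrary measure, so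
  a truncated law can be inserted as it is.\<close>

lemma tilted_lower_bound:
  fixes R Y :: "nat \<Rightarrow> 'b \<Rightarrow> real" and \<phi> :: "real \<Rightarrow> real \<Rightarrow> real"
  assumes meas [measurable]: "\<And>n. n \<ge> 1 \<Longrightarrow> R n \<in> borel_measurable (Q n)" "\<And>n. n \<ge> 1 \<Longrightarrow> Y n \<in> borel_measurable (Q n)"
    and D: "open D" "t0 \<in> D"
    and mgf: "\<And>n s0 s1. n \<ge> 1 \<Longrightarrow> s0 \<in> D \<Longrightarrow>
      (\<integral>\<^sup>+ \<omega>. ennreal (exp (real n * (s0 * R n \<omega> + s1 * Y n \<omega>))) \<partial>Q n) = ennreal (exp (real n * \<phi> s0 s1))"
    and der: "((\<lambda>s. \<phi> s t1) has_real_derivative a) (at t0)" "((\<lambda>s. \<phi> t0 s) has_real_derivative b) (at t1)"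
    and pos: "\<delta>' > 0" "\<eta> > 0"
  shows "\<forall>\<^sub>F n in sequentially. ennreal (exp (real n * (\<phi> t0 t1 - t0 * a - t1 * b - \<eta>))) \<le>
    emeasure (Q n) {\<omega> \<in> space (Q n). \<bar>R n \<omega> - a\<bar> < \<delta>' \<and> \<bar>Y n \<omega> - b\<bar> < \<delta>'}"
proof -
  define T where "T = \<bar>t0\<bar> + \<bar>t1\<bar>"
  \<comment> \<open>In a box of this size the exponent varies by at most
    \<open>T * \<delta> <= \<eta> / 2\<close>; the summand 1 covers \<open>T = 0\<close>.\<close>
  define \<delta> where "\<delta> = min \<delta>' (\<eta> / (2 * (T + 1)))"
  have T: "T \<ge> 0" by (simp add: T_def)
  have \<delta>: "\<delta> > 0" "\<delta> \<le> \<delta>'" using pos T by (auto simp: \<delta>_def)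
  have "T * \<delta> \<le> T * (\<eta> / (2 * (T + 1)))" using T by (intro mult_left_mono) (auto simp: \<delta>_def)
  also have "\<dots> \<le> \<eta> / 2" using T pos by (simp add: field_simps)
  finally have T\<delta>: "T * \<delta> \<le> \<eta> / 2" .
  obtain \<epsilon> where \<epsilon>: "\<epsilon> > 0" "ball t0 \<epsilon> \<subseteq> D" using D open_contains_ball by blast
  have inD: "t0 + h \<in> D" "t0 - h \<in> D" if "\<bar>h\<bar> < \<epsilon>" for h
    using \<epsilon>(2) that by (auto simp: subset_eq dist_real_def)
  define V where "V n \<omega> = t0 * R n \<omega> + t1 * Y n \<omega>" for n \<omega>
  have V [measurable]: "\<And>n. n \<ge> 1 \<Longrightarrow> V n \<in> borel_measurable (Q n)" unfolding V_def by measurable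
  have der': "((\<lambda>h. \<phi> (t0 + h) t1) has_real_derivative a) (at 0)"
      "((\<lambda>h. \<phi> (t0 - h) t1) has_real_derivative - a) (at 0)"
      "((\<lambda>h. \<phi> t0 (t1 + h)) has_real_derivative b) (at 0)"
      "((\<lambda>h. \<phi> t0 (t1 - h)) has_real_derivative - b) (at 0)"
    by (rule DERIV_shift_zero(1)[OF der(1)] DERIV_shift_zero(2)[OF der(1)]
        DERIV_shift_zero(1)[OF der(2)] DERIV_shift_zero(2)[OF der(2)])+
  have "\<exists>\<kappa>>0. \<forall>n\<ge>1. (\<integral>\<^sup>+ \<omega>. indicator {\<omega>. a + \<delta> \<le> R n \<omega>} \<omega> * ennreal (exp (real n * V n \<omega>)) \<partial>Q n)
    \<le> ennreal (exp (real n * (\<phi> (t0 + 0) t1 - \<kappa>)))"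
    by (rule tilted_tail[OF V meas(1) _ der'(1) \<epsilon>(1) \<delta>(1)])
      (use mgf[of _ "t0 + _" t1] inD in \<open>simp_all add: V_def algebra_simps\<close>)
  then obtain \<kappa>1 where k1: "\<kappa>1 > 0" "\<And>n. n \<ge> 1 \<Longrightarrow> (\<integral>\<^sup>+ \<omega>. indicator {\<omega>. a + \<delta> \<le> R n \<omega>} \<omega> * ennreal (exp (real n * V n \<omega>)) \<partial>Q n)
    \<le> ennreal (exp (real n * (\<phi> t0 t1 - \<kappa>1)))" by auto
  have "\<exists>\<kappa>>0. \<forall>n\<ge>1. (\<integral>\<^sup>+ \<omega>. indicator {\<omega>. - a + \<delta> \<le> - R n \<omega>} \<omega> * ennreal (exp (real n * V n \<omega>)) \<partial>Q n)
    \<le> ennreal (exp (real n * (\<phi> (t0 - 0) t1 - \<kappa>)))"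
    by (rule tilted_tail[OF V _ _ der'(2) \<epsilon>(1) \<delta>(1)])
      (use mgf[of _ "t0 - _" t1] inD in \<open>simp_all add: V_def algebra_simps\<close>)
  then obtain \<kappa>2 where k2: "\<kappa>2 > 0" "\<And>n. n \<ge> 1 \<Longrightarrow> (\<integral>\<^sup>+ \<omega>. indicator {\<omega>. - a + \<delta> \<le> - R n \<omega>} \<omega> * ennreal (exp (real n * V n \<omega>)) \<partial>Q n)
    \<le> ennreal (exp (real n * (\<phi> t0 t1 - \<kappa>2)))" by auto
  have "\<exists>\<kappa>>0. \<forall>n\<ge>1. (\<integral>\<^sup>+ \<omega>. indicator {\<omega>. b + \<delta> \<le> Y n \<omega>} \<omega> * ennreal (exp (real n * V n \<omega>)) \<partial>Q n)
    \<le> ennreal (exp (real n * (\<phi> t0 (t1 + 0) - \<kappa>)))"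
    by (rule tilted_tail[OF V meas(2) _ der'(3) \<epsilon>(1) \<delta>(1)])
      (use mgf[of _ t0 "t1 + _"] D in \<open>simp_all add: V_def algebra_simps\<close>)
  then obtain \<kappa>3 where k3: "\<kappa>3 > 0" "\<And>n. n \<ge> 1 \<Longrightarrow> (\<integral>\<^sup>+ \<omega>. indicator {\<omega>. b + \<delta> \<le> Y n \<omega>} \<omega> * ennreal (exp (real n * V n \<omega>)) \<partial>Q n)
    \<le> ennreal (exp (real n * (\<phi> t0 t1 - \<kappa>3)))" by auto
  have "\<exists>\<kappa>>0. \<forall>n\<ge>1. (\<integral>\<^sup>+ \<omega>. indicator {\<omega>. - b + \<delta> \<le> - Y n \<omega>} \<omega> * ennreal (exp (real n * V n \<omega>)) \<partial>Q n)
    \<le> ennreal (exp (real n * (\<phi> t0 (t1 - 0) - \<kappa>)))"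
    by (rule tilted_tail[OF V _ _ der'(4) \<epsilon>(1) \<delta>(1)])
      (use mgf[of _ t0 "t1 - _"] D in \<open>simp_all add: V_def algebra_simps\<close>)
  then obtain \<kappa>4 where k4: "\<kappa>4 > 0" "\<And>n. n \<ge> 1 \<Longrightarrow> (\<integral>\<^sup>+ \<omega>. indicator {\<omega>. - b + \<delta> \<le> - Y n \<omega>} \<omega> * ennreal (exp (real n * V n \<omega>)) \<partial>Q n)
    \<le> ennreal (exp (real n * (\<phi> t0 t1 - \<kappa>4)))" by auto
  define \<kappa> where "\<kappa> = min (min \<kappa>1 \<kappa>2) (min \<kappa>3 \<kappa>4)"
  have \<kappa>: "\<kappa> > 0" "\<kappa> \<le> \<kappa>1" "\<kappa> \<le> \<kappa>2" "\<kappa> \<le> \<kappa>3" "\<kappa> \<le> \<kappa>4"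
    using k1 k2 k3 k4 by (auto simp: \<kappa>_def)
  have lim: "((\<lambda>n. exp (- (c * real n))) \<longlongrightarrow> 0) sequentially" if "c > 0" for c :: real
    using that by real_asymp
  \<comment> \<open>Four tails of at most an eighth of the mass each leave half of it in the box;
    the next condition absorbs this factor 1/2 into \<open>\<eta> / 2\<close>.\<close>
  have "\<forall>\<^sub>F n in sequentially. exp (- (\<kappa> * real n)) < 1 / 8"
    using order_tendstoD(2)[OF lim[OF \<kappa>(1)], of "1/8"] by simp
  moreover have "\<forall>\<^sub>F n in sequentially. exp (- ((\<eta> / 2) * real n)) < 1 / 2"
    using order_tendstoD(2)[OF lim[of "\<eta>/2"], of "1/2"] pos by simp
  ultimately show ?thesis using eventually_ge_at_top[of 1]
  proof eventually_elim
    case (elim n)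
    note n = elim(3)
    note [measurable] = V[OF n] meas[OF n]
    define good where "good = {\<omega> \<in> space (Q n). \<bar>R n \<omega> - a\<bar> < \<delta> \<and> \<bar>Y n \<omega> - b\<bar> < \<delta>}"
    have [measurable]: "good \<in> sets (Q n)" unfolding good_def by measurable
    define E where "E = exp (real n * (t0 * a + t1 * b + T * \<delta>))"
    define K where "K = exp (real n * (\<phi> t0 t1 - \<kappa>))"
    let ?t = "\<lambda>S. \<integral>\<^sup>+ \<omega>. indicator S \<omega> * ennreal (exp (real n * V n \<omega>)) \<partial>Q n"
    have tail: "?t S \<le> ennreal K" if "?t S \<le> ennreal (exp (real n * (\<phi> t0 t1 - \<kappa>')))" "\<kappa> \<le> \<kappa>'" for S \<kappa>'
      using that(1)
    proof (rule order_trans)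
      show "ennreal (exp (real n * (\<phi> t0 t1 - \<kappa>'))) \<le> ennreal K"
        unfolding K_def using that(2) by (intro ennreal_leI) (simp add: mult_left_mono)
    qed
    have "ennreal (exp (real n * \<phi> t0 t1)) = (\<integral>\<^sup>+ \<omega>. ennreal (exp (real n * V n \<omega>)) \<partial>Q n)"
      unfolding V_def using mgf[OF n D(2)] by simp
    also have "\<dots> \<le> (\<integral>\<^sup>+ \<omega>. ennreal E * indicator good \<omega> +
        (indicator {\<omega>. a + \<delta> \<le> R n \<omega>} \<omega> * ennreal (exp (real n * V n \<omega>)) +
        (indicator {\<omega>. - a + \<delta> \<le> - R n \<omega>} \<omega> * ennreal (exp (real n * V n \<omega>)) +
        (indicator {\<omega>. b + \<delta> \<le> Y n \<omega>} \<omega> * ennreal (exp (real n * V n \<omega>)) +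
         indicator {\<omega>. - b + \<delta> \<le> - Y n \<omega>} \<omega> * ennreal (exp (real n * V n \<omega>))))) \<partial>Q n)"
    proof (rule nn_integral_mono)
      fix \<omega> assume \<omega>: "\<omega> \<in> space (Q n)"
      consider "\<omega> \<in> good" | "a + \<delta> \<le> R n \<omega>" | "- a + \<delta> \<le> - R n \<omega>" | "b + \<delta> \<le> Y n \<omega>" | "- b + \<delta> \<le> - Y n \<omega>"
        using \<omega> unfolding good_def by force
      then show "ennreal (exp (real n * V n \<omega>)) \<le> ennreal E * indicator good \<omega> +
        (indicator {\<omega>. a + \<delta> \<le> R n \<omega>} \<omega> * ennreal (exp (real n * V n \<omega>)) +
        (indicator {\<omega>. - a + \<delta> \<le> - R n \<omega>} \<omega> * ennreal (exp (real n * V n \<omega>)) +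
        (indicator {\<omega>. b + \<delta> \<le> Y n \<omega>} \<omega> * ennreal (exp (real n * V n \<omega>)) +
         indicator {\<omega>. - b + \<delta> \<le> - Y n \<omega>} \<omega> * ennreal (exp (real n * V n \<omega>)))))"
      proof cases
        case 1
        then have R: "\<bar>R n \<omega> - a\<bar> \<le> \<delta>" and Y: "\<bar>Y n \<omega> - b\<bar> \<le> \<delta>" by (auto simp: good_def)
        have "t0 * (R n \<omega> - a) + t1 * (Y n \<omega> - b) \<le> \<bar>t0\<bar> * \<bar>R n \<omega> - a\<bar> + \<bar>t1\<bar> * \<bar>Y n \<omega> - b\<bar>"
          unfolding abs_mult[symmetric] by (intro add_mono abs_ge_self)
        also have "\<dots> \<le> \<bar>t0\<bar> * \<delta> + \<bar>t1\<bar> * \<delta>" using R Y by (intro add_mono mult_left_mono) auto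
        finally have "V n \<omega> \<le> t0 * a + t1 * b + T * \<delta>" by (simp add: V_def T_def algebra_simps)
        then have "ennreal (exp (real n * V n \<omega>)) \<le> ennreal E * indicator good \<omega>"
          unfolding E_def using 1 by (auto intro!: ennreal_leI mult_left_mono)
        then show ?thesis by (rule order_trans) simp
      qed (auto intro: add_increasing add_increasing2 simp: add.assoc[symmetric])
    qed
    also have "\<dots> = ennreal E * emeasure (Q n) good + (?t {\<omega>. a + \<delta> \<le> R n \<omega>} + (?t {\<omega>. - a + \<delta> \<le> - R n \<omega>} +
        (?t {\<omega>. b + \<delta> \<le> Y n \<omega>} + ?t {\<omega>. - b + \<delta> \<le> - Y n \<omega>})))"
    proof -
      have [measurable]: "(\<lambda>\<omega>. indicator {\<omega>. a + \<delta> \<le> R n \<omega>} \<omega> * ennreal (exp (real n * V n \<omega>))) \<in> borel_measurable (Q n)"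
        "(\<lambda>\<omega>. indicator {\<omega>. - a + \<delta> \<le> - R n \<omega>} \<omega> * ennreal (exp (real n * V n \<omega>))) \<in> borel_measurable (Q n)"
        "(\<lambda>\<omega>. indicator {\<omega>. b + \<delta> \<le> Y n \<omega>} \<omega> * ennreal (exp (real n * V n \<omega>))) \<in> borel_measurable (Q n)"
        "(\<lambda>\<omega>. indicator {\<omega>. - b + \<delta> \<le> - Y n \<omega>} \<omega> * ennreal (exp (real n * V n \<omega>))) \<in> borel_measurable (Q n)"
        by (auto simp: indicator_def[abs_def])
      show ?thesis
        by (subst nn_integral_add, measurable)+ (simp add: nn_integral_cmult_indicator)
    qed
    also have "\<dots> \<le> ennreal E * emeasure (Q n) good + (ennreal K + (ennreal K + (ennreal K + ennreal K)))"
      using k1(2)[OF n] k2(2)[OF n] k3(2)[OF n] k4(2)[OF n] \<kappa>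
      by (intro add_mono order_refl tail[of _ \<kappa>1] tail[of _ \<kappa>2] tail[of _ \<kappa>3] tail[of _ \<kappa>4])
    finally have main: "ennreal (exp (real n * \<phi> t0 t1)) \<le> ennreal E * emeasure (Q n) good + ennreal (4 * K)"
      by (simp add: ennreal_plus[symmetric] K_def del: ennreal_plus)
    have "ennreal (exp (real n * (\<phi> t0 t1 - t0 * a - t1 * b - \<eta>))) \<le> emeasure (Q n) good"
    proof (cases "emeasure (Q n) good")
      case top
      then show ?thesis by simp
    next
      case (real q)
      have E: "E > 0" and K: "K \<ge> 0" by (auto simp: E_def K_def)
      have "ennreal (exp (real n * \<phi> t0 t1)) \<le> ennreal (E * q + 4 * K)"
        using main real E K by (simp add: ennreal_mult ennreal_plus)
      then have "exp (real n * \<phi> t0 t1) \<le> E * q + 4 * K"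
        using real E K by (subst (asm) ennreal_le_iff) auto
      moreover have "K = exp (real n * \<phi> t0 t1) * exp (- (\<kappa> * real n))"
        by (simp add: K_def exp_add[symmetric] algebra_simps)
      moreover have "exp (real n * \<phi> t0 t1) * exp (- (\<kappa> * real n)) \<le> exp (real n * \<phi> t0 t1) * (1 / 8)"
        using elim(1) by (intro mult_left_mono) auto
      ultimately have half: "exp (real n * \<phi> t0 t1) * (1 / 2) \<le> E * q" by linarith
      have "exp (real n * (\<phi> t0 t1 - \<eta> / 2)) = exp (real n * \<phi> t0 t1) * exp (- ((\<eta> / 2) * real n))"
        by (simp add: exp_add[symmetric] algebra_simps)
      also have "\<dots> \<le> exp (real n * \<phi> t0 t1) * (1 / 2)" using elim(2) by (intro mult_left_mono) auto
      also have "\<dots> \<le> E * q" by (rule half)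
      finally have "exp (real n * (\<phi> t0 t1 - \<eta> / 2)) / E \<le> q" using E by (simp add: field_simps)
      moreover have "exp (real n * (\<phi> t0 t1 - \<eta> / 2)) / E =
          exp (real n * (\<phi> t0 t1 - \<eta> / 2 - (t0 * a + t1 * b + T * \<delta>)))"
        by (simp add: E_def exp_diff[symmetric] algebra_simps)
      moreover have "real n * (\<phi> t0 t1 - t0 * a - t1 * b - \<eta>) \<le> real n * (\<phi> t0 t1 - \<eta> / 2 - (t0 * a + t1 * b + T * \<delta>))"
        using T\<delta> by (intro mult_left_mono) auto
      ultimately have "exp (real n * (\<phi> t0 t1 - t0 * a - t1 * b - \<eta>)) \<le> q"
        by (metis exp_le_cancel_iff order_trans)
      then show ?thesis using real by (auto intro: ennreal_leI)
    qed
    also have "\<dots> \<le> emeasure (Q n) {\<omega> \<in> space (Q n). \<bar>R n \<omega> - a\<bar> < \<delta>' \<and> \<bar>Y n \<omega> - b\<bar> < \<delta>'}"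
    proof (rule emeasure_mono)
      show "good \<subseteq> {\<omega> \<in> space (Q n). \<bar>R n \<omega> - a\<bar> < \<delta>' \<and> \<bar>Y n \<omega> - b\<bar> < \<delta>'}"
        using \<delta> by (auto simp: good_def)
    qed measurable
    finally show ?case .
  qed
qed

subsection \<open>Truncated moment generating functions\<close>

text \<open>Dominates the difference quotients of \<open>exp (s x^2)\<close> in
  \<open>DERIV_trunc_mgf\<close>; both signs reduce to \<open>1 + b <= exp b\<close>.\<close>

lemma abs_exp_minus_one_le: "\<bar>exp a - 1\<bar> \<le> \<bar>a\<bar> * exp \<bar>a\<bar>" for a :: real
proof (cases "a \<ge> 0")
  case True
  have "1 - a \<le> exp (- a)" using exp_ge_add_one_self[of "- a"] by simp
  then have "(1 - a) * exp a \<le> exp (- a) * exp a" by (intro mult_right_mono) auto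
  then show ?thesis using True by (simp add: exp_minus algebra_simps)
next
  case False
  have "1 - exp a \<le> - a" using exp_ge_add_one_self[of a] by linarith
  also have "\<dots> \<le> - a * exp (- a)" using False mult_left_mono[of 1 "exp (- a)" "- a"] by simp
  finally show ?thesis using False by simp
qed

text \<open>Once \<open>z\<close> is integrated out, the parameters enter only through
  \<open>s = t1^2 / (2 (1 - 2 t0))\<close> and the prefactor \<open>1 / sqrt (1 - 2 t0)\<close>, so
  this function of a single variable carries all dependence on \<open>\<gamma>\<close>.\<close>

definition trunc_mgf :: "real measure \<Rightarrow> real \<Rightarrow> real \<Rightarrow> real" where
  "trunc_mgf \<gamma> m s = (\<integral>x. indicator {-m..m} x * exp (s * x\<^sup>2) \<partial>\<gamma>)"

locale real_prob = prob_space \<gamma> for \<gamma> :: "real measure" +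
  assumes sets_\<gamma> [measurable_cong, simp]: "sets \<gamma> = sets borel"
begin

lemma space_\<gamma> [simp]: "space \<gamma> = UNIV"
  using sets_eq_imp_space_eq[OF sets_\<gamma>] by simp

lemma sq_le_if_trunc: "x \<in> {-m..m} \<Longrightarrow> x\<^sup>2 \<le> m\<^sup>2" for x m :: real
  by (auto simp: abs_le_square_iff[symmetric])

lemma trunc_exp_bound:
  "\<bar>indicator {-m..m} x * exp (s * x\<^sup>2)\<bar> \<le> exp (\<bar>s\<bar> * m\<^sup>2)" for x m s :: real
proof (cases "x \<in> {-m..m}")
  case True
  have "s * x\<^sup>2 \<le> \<bar>s\<bar> * m\<^sup>2" using sq_le_if_trunc[OF True] by (intro mult_mono) auto
  then show ?thesis using True by simp
qed simp

lemma integrable_trunc: "integrable \<gamma> (\<lambda>x. indicator {-m..m} x * exp (s * x\<^sup>2))"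
  by (rule integrable_const_bound[where B = "exp (\<bar>s\<bar> * m\<^sup>2)"])
    (auto intro!: AE_I2 order_trans[OF abs_ge_self trunc_exp_bound])

lemma nn_integral_trunc:
  "(\<integral>\<^sup>+ x. indicator {-m..m} x * ennreal (exp (s * x\<^sup>2)) \<partial>\<gamma>) = ennreal (trunc_mgf \<gamma> m s)"
proof -
  have "(\<integral>\<^sup>+ x. indicator {-m..m} x * ennreal (exp (s * x\<^sup>2)) \<partial>\<gamma>) =
      (\<integral>\<^sup>+ x. ennreal (indicator {-m..m} x * exp (s * x\<^sup>2)) \<partial>\<gamma>)"
    by (intro nn_integral_cong) (auto simp: indicator_def)
  also have "\<dots> = ennreal (trunc_mgf \<gamma> m s)"
    unfolding trunc_mgf_def by (rule nn_integral_eq_integral[OF integrable_trunc]) auto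
  finally show ?thesis .
qed

lemma trunc_mgf_zero: "trunc_mgf \<gamma> m 0 = measure \<gamma> {-m..m}"
  by (simp add: trunc_mgf_def)

text \<open>Keeping only the points with \<open>x^2 >= v\<close> gives exponential growth in
  \<open>s\<close>, the source of coercivity of the dual problem.\<close>

lemma trunc_mgf_ge:
  assumes "s \<ge> 0"
  shows "exp (s * v) * measure \<gamma> {x. x \<in> {-m..m} \<and> v \<le> x\<^sup>2} \<le> trunc_mgf \<gamma> m s"
proof -
  have [measurable]: "{x::real. x \<in> {-m..m} \<and> v \<le> x\<^sup>2} \<in> sets borel" by measurable
  have "(\<integral>x. indicator {x. x \<in> {-m..m} \<and> v \<le> x\<^sup>2} x * exp (s * v) \<partial>\<gamma>) \<le> trunc_mgf \<gamma> m s"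
    unfolding trunc_mgf_def
  proof (rule integral_mono)
    show "integrable \<gamma> (\<lambda>x. indicator {x. x \<in> {-m..m} \<and> v \<le> x\<^sup>2} x * exp (s * v))"
      by (rule integrable_const_bound[where B = "exp (s * v)"]) (auto simp: indicator_def)
    show "indicator {x. x \<in> {-m..m} \<and> v \<le> x\<^sup>2} x * exp (s * v) \<le> indicator {-m..m} x * exp (s * x\<^sup>2)" for x
      using assms by (auto simp: indicator_def mult_left_mono)
  qed (rule integrable_trunc)
  then show ?thesis by (simp add: mult.commute)
qed

lemma trunc_mgf_mono: "m \<le> m' \<Longrightarrow> trunc_mgf \<gamma> m s \<le> trunc_mgf \<gamma> m' s"
  unfolding trunc_mgf_def
  by (rule integral_mono[OF integrable_trunc integrable_trunc]) (auto simp: indicator_def)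

lemma trunc_mgf_pos:
  assumes "measure \<gamma> {-m..m} > 0"
  shows "trunc_mgf \<gamma> m s > 0"
proof -
  have "(\<integral>x. indicator {-m..m} x * exp (- \<bar>s\<bar> * m\<^sup>2) \<partial>\<gamma>) \<le> trunc_mgf \<gamma> m s"
    unfolding trunc_mgf_def
  proof (rule integral_mono)
    show "integrable \<gamma> (\<lambda>x. indicator {-m..m} x * exp (- \<bar>s\<bar> * m\<^sup>2))"
      by (rule integrable_const_bound[where B = "exp (- \<bar>s\<bar> * m\<^sup>2)"]) (auto simp: indicator_def)
    show "indicator {-m..m} x * exp (- \<bar>s\<bar> * m\<^sup>2) \<le> indicator {-m..m} x * exp (s * x\<^sup>2)" for x
    proof (cases "x \<in> {-m..m}")
      case True
      have "- s * x\<^sup>2 \<le> \<bar>s\<bar> * m\<^sup>2" using sq_le_if_trunc[OF True] by (intro mult_mono) auto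
      then show ?thesis using True by simp
    qed simp
  qed (rule integrable_trunc)
  moreover have "(\<integral>x. indicator {-m..m} x * exp (- \<bar>s\<bar> * m\<^sup>2) \<partial>\<gamma>) > 0"
    using assms by simp
  ultimately show ?thesis by linarith
qed

text \<open>Dominated convergence along null sequences: the window bounds \<open>x^2\<close> by
  \<open>m^2\<close>, so a constant dominates the difference quotients.\<close>

lemma DERIV_trunc_mgf:
  "(trunc_mgf \<gamma> m has_real_derivative (\<integral>x. indicator {-m..m} x * exp (s * x\<^sup>2) * x\<^sup>2 \<partial>\<gamma>)) (at s)"
  unfolding DERIV_def tendsto_at_iff_sequentially
proof (intro allI impI)
  fix h :: "nat \<Rightarrow> real"
  assume h0: "\<forall>i. h i \<in> UNIV - {0}" and h: "h \<longlonglongrightarrow> 0"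
  obtain K where K: "\<And>i. \<bar>h i\<bar> \<le> K"
    using convergent_imp_Bseq[OF convergentI[OF h]] by (auto simp: Bseq_def)
  have "(\<lambda>i. \<integral>x. indicator {-m..m} x * exp (s * x\<^sup>2) * ((exp (h i * x\<^sup>2) - 1) / h i) \<partial>\<gamma>)
      \<longlonglongrightarrow> (\<integral>x. indicator {-m..m} x * exp (s * x\<^sup>2) * x\<^sup>2 \<partial>\<gamma>)"
  proof (rule integral_dominated_convergence[where w = "\<lambda>_. exp (\<bar>s\<bar> * m\<^sup>2) * (m\<^sup>2 * exp (K * m\<^sup>2))"])
    have "(\<lambda>i. (exp (h i * x\<^sup>2) - 1) / h i) \<longlonglongrightarrow> x\<^sup>2" for x
    proof -
      have "((\<lambda>t. exp (t * x\<^sup>2)) has_real_derivative x\<^sup>2) (at 0)"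
        by (auto intro!: derivative_eq_intros)
      then have "((\<lambda>t. (exp (t * x\<^sup>2) - 1) / t) \<longlongrightarrow> x\<^sup>2) (at 0)"
        by (simp add: DERIV_def)
      then show ?thesis using h0 h unfolding tendsto_at_iff_sequentially by (auto simp: o_def)
    qed
    then show "AE x in \<gamma>. (\<lambda>i. indicator {-m..m} x * exp (s * x\<^sup>2) * ((exp (h i * x\<^sup>2) - 1) / h i))
        \<longlonglongrightarrow> indicator {-m..m} x * exp (s * x\<^sup>2) * x\<^sup>2"
      by (intro AE_I2 tendsto_mult tendsto_const)
    show "AE x in \<gamma>. norm (indicator {-m..m} x * exp (s * x\<^sup>2) * ((exp (h i * x\<^sup>2) - 1) / h i))
        \<le> exp (\<bar>s\<bar> * m\<^sup>2) * (m\<^sup>2 * exp (K * m\<^sup>2))" for i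
    proof (rule AE_I2)
      fix x
      show "norm (indicator {-m..m} x * exp (s * x\<^sup>2) * ((exp (h i * x\<^sup>2) - 1) / h i))
        \<le> exp (\<bar>s\<bar> * m\<^sup>2) * (m\<^sup>2 * exp (K * m\<^sup>2))"
      proof (cases "x \<in> {-m..m}")
        case True
        note sq = sq_le_if_trunc[OF True]
        have "\<bar>exp (h i * x\<^sup>2) - 1\<bar> \<le> \<bar>h i\<bar> * (x\<^sup>2 * exp (\<bar>h i\<bar> * x\<^sup>2))"
          using abs_exp_minus_one_le[of "h i * x\<^sup>2"] by (simp add: abs_mult mult.assoc)
        then have "\<bar>(exp (h i * x\<^sup>2) - 1) / h i\<bar> \<le> x\<^sup>2 * exp (\<bar>h i\<bar> * x\<^sup>2)"
          using h0 by (simp add: field_simps)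
        also have "\<dots> \<le> m\<^sup>2 * exp (K * m\<^sup>2)"
          using sq K[of i] by (intro mult_mono) (auto intro!: mult_mono)
        finally have "\<bar>(exp (h i * x\<^sup>2) - 1) / h i\<bar> \<le> m\<^sup>2 * exp (K * m\<^sup>2)" .
        then show ?thesis unfolding real_norm_def abs_mult[of "_ * _"]
          by (intro mult_mono trunc_exp_bound) auto
      qed simp
    qed
  qed auto
  also have "(\<lambda>i. \<integral>x. indicator {-m..m} x * exp (s * x\<^sup>2) * ((exp (h i * x\<^sup>2) - 1) / h i) \<partial>\<gamma>)
     = (\<lambda>t. (trunc_mgf \<gamma> m (s + t) - trunc_mgf \<gamma> m s) / t) \<circ> h"
  proof
    fix i
    have "(trunc_mgf \<gamma> m (s + h i) - trunc_mgf \<gamma> m s) / h i =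
      (\<integral>x. (indicator {-m..m} x * exp ((s + h i) * x\<^sup>2) - indicator {-m..m} x * exp (s * x\<^sup>2)) / h i \<partial>\<gamma>)"
      unfolding trunc_mgf_def by (simp add: Bochner_Integration.integral_diff[OF integrable_trunc integrable_trunc])
    also have "\<dots> = (\<integral>x. indicator {-m..m} x * exp (s * x\<^sup>2) * ((exp (h i * x\<^sup>2) - 1) / h i) \<partial>\<gamma>)"
      by (intro Bochner_Integration.integral_cong) (auto simp: exp_add algebra_simps)
    finally show "(\<integral>x. indicator {-m..m} x * exp (s * x\<^sup>2) * ((exp (h i * x\<^sup>2) - 1) / h i) \<partial>\<gamma>) =
       ((\<lambda>t. (trunc_mgf \<gamma> m (s + t) - trunc_mgf \<gamma> m s) / t) \<circ> h) i" unfolding o_def by (rule sym)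
  qed
  finally show "((\<lambda>t. (trunc_mgf \<gamma> m (s + t) - trunc_mgf \<gamma> m s) / t) \<circ> h)
      \<longlonglongrightarrow> (\<integral>x. indicator {-m..m} x * exp (s * x\<^sup>2) * x\<^sup>2 \<partial>\<gamma>)" .
qed

lemma slice_mgf_eq:
  assumes "t0 < 1 / 2" "B \<in> sets borel"
  shows "slice_mgf \<gamma> B t0 t1 = ennreal (1 / sqrt (1 - 2 * t0)) *
    (\<integral>\<^sup>+ x. indicator B x * ennreal (exp (t1\<^sup>2 / (2 * (1 - 2 * t0)) * x\<^sup>2)) \<partial>\<gamma>)"
proof -
  have inner: "(\<integral>\<^sup>+ z. ennreal (exp (t0 * z\<^sup>2 + t1 * z * x)) \<partial>std_normal_distribution) =
      ennreal (1 / sqrt (1 - 2 * t0)) * ennreal (exp (t1\<^sup>2 / (2 * (1 - 2 * t0)) * x\<^sup>2))" for x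
    using nn_integral_gauss_quadratic[OF assms(1), of "t1 * x"] assms(1)
    by (simp add: ennreal_mult[symmetric] ac_simps power_mult_distrib)
  note [measurable] = assms(2)
  show ?thesis
    unfolding slice_mgf_def inner by (subst nn_integral_cmult[symmetric]) (auto simp: ac_simps)
qed

text \<open>The logarithm of \<open>slice_mgf\<close> on \<open>{-m..m}\<close> in closed form; this
  reading is valid for \<open>t0 < 1/2\<close> and a window of positive mass.\<close>

definition trunc_lmgf :: "real \<Rightarrow> real \<Rightarrow> real \<Rightarrow> real" where
  "trunc_lmgf m t0 t1 = ln (trunc_mgf \<gamma> m (t1\<^sup>2 / (2 * (1 - 2 * t0))) / sqrt (1 - 2 * t0))"

lemma slice_mgf_trunc:
  assumes "t0 < 1 / 2" "measure \<gamma> {-m..m} > 0"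
  shows "slice_mgf \<gamma> {-m..m} t0 t1 = ennreal (exp (trunc_lmgf m t0 t1))"
proof -
  have "slice_mgf \<gamma> {-m..m} t0 t1 =
      ennreal (1 / sqrt (1 - 2 * t0)) * ennreal (trunc_mgf \<gamma> m (t1\<^sup>2 / (2 * (1 - 2 * t0))))"
    by (subst slice_mgf_eq[OF assms(1)]) (simp_all only: nn_integral_trunc, simp)
  then show ?thesis
    using assms trunc_mgf_pos[OF assms(2), of "t1\<^sup>2 / (2 * (1 - 2 * t0))"]
    by (simp add: trunc_lmgf_def ennreal_mult[symmetric] less_imp_le)
qed

lemma \<Phi>_eq_slice_mgf: "\<Phi> \<gamma> (t0, t1) = log_ennreal (slice_mgf \<gamma> UNIV t0 t1)"
  by (simp add: \<Phi>_def slice_mgf_def)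

text \<open>Such points contribute minus infinity to the Legendre transform, which confines the dual
  variable to the half-plane where the closed form applies.\<close>

lemma \<Phi>_infinite:
  assumes "t0 \<ge> 1 / 2"
  shows "\<Phi> \<gamma> (t0, t1) = \<infinity>"
proof -
  have "slice_mgf \<gamma> UNIV t0 t1 = \<infinity>"
    using nn_integral_gauss_quadratic_infinite[OF assms, of "t1 * _"]
    by (simp add: slice_mgf_def ac_simps emeasure_space_1[unfolded space_\<gamma>])
  then show ?thesis by (simp add: \<Phi>_eq_slice_mgf log_ennreal_def)
qed

end

subsection \<open>The rate function\<close>

text \<open>This equivalence and the next one absorb the values of \<open>log_ennreal\<close> at 0
  and infinity, so that bounds on logarithms and on probabilities can be interchanged without case
  distinctions.\<close>

lemma log_ennreal_le_iff: "log_ennreal x \<le> ereal r \<longleftrightarrow> x \<le> ennreal (exp r)"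
proof (cases x)
  case (real y)
  show ?thesis
  proof (cases "y = 0")
    case False
    then have "y > 0" using real by simp
    then have "ln y \<le> r \<longleftrightarrow> y \<le> exp r" by (metis exp_ln exp_le_cancel_iff)
    then show ?thesis using real False by (simp add: log_ennreal_def)
  qed (use real in \<open>simp add: log_ennreal_def\<close>)
qed (simp add: log_ennreal_def top_unique)

lemma log_ennreal_ge_iff: "ereal r \<le> log_ennreal x \<longleftrightarrow> ennreal (exp r) \<le> x"
proof (cases x)
  case (real y)
  show ?thesis
  proof (cases "y = 0")
    case False
    then have "y > 0" using real by simp
    then have "r \<le> ln y \<longleftrightarrow> exp r \<le> y" by (metis exp_ln exp_le_cancel_iff)
    then show ?thesis using real False by (simp add: log_ennreal_def)
  qed (use real in \<open>simp add: log_ennreal_def\<close>)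
qed (simp add: log_ennreal_def)

lemma legendre_upper: "ereal (t0 * \<tau>0 + t1 * \<tau>1) - \<Lambda> (t0, t1) \<le> legendre \<Lambda> (\<tau>0, \<tau>1)"
  for t0 t1 \<tau>0 \<tau>1 :: real
  unfolding legendre_def by (rule SUP_upper2[of "(t0, t1)"]) auto

lemma legendre_le_iff:
  "legendre \<Lambda> (\<tau>0, \<tau>1) \<le> c \<longleftrightarrow> (\<forall>t0 t1. ereal (t0 * \<tau>0 + t1 * \<tau>1) - \<Lambda> (t0, t1) \<le> c)"
  for \<tau>0 \<tau>1 :: real
  unfolding legendre_def SUP_le_iff by auto

context real_prob
begin

text \<open>Replacing \<open>(t\<^sub>0, t\<^sub>1)\<close> by \<open>((1 - (1 - 2 t\<^sub>0) / \<tau>\<^sub>0) / 2, t\<^sub>1 / \<surd>\<tau>\<^sub>0)\<close> shows that the infimum defining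
  \<open>I_an\<close> is attained at \<open>\<tau>\<^sub>0 = 1\<close>.\<close>

lemma I_an_eq: "I_an \<gamma> w = legendre (\<Phi> \<gamma>) (1, w)"
proof (rule antisym)
  show "I_an \<gamma> w \<le> legendre (\<Phi> \<gamma>) (1, w)"
    unfolding I_an_def
    by (rule Inf_lower, rule CollectI, rule exI[of _ 1], rule exI[of _ w]) simp
  show "legendre (\<Phi> \<gamma>) (1, w) \<le> I_an \<gamma> w"
    unfolding I_an_def
  proof (rule Inf_greatest, clarify)
    fix \<tau>0 \<tau>1 :: real
    assume pos: "\<tau>0 > 0" and w: "w = \<tau>0 powr (- 1 / 2) * \<tau>1"
    show "legendre (\<Phi> \<gamma>) (1, \<tau>0 powr (- 1 / 2) * \<tau>1) \<le> legendre (\<Phi> \<gamma>) (\<tau>0, \<tau>1)"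
      unfolding w[symmetric] legendre_le_iff
    proof (intro allI)
      fix t0 t1
      show "ereal (t0 * 1 + t1 * w) - \<Phi> \<gamma> (t0, t1) \<le> legendre (\<Phi> \<gamma>) (\<tau>0, \<tau>1)"
      proof (cases "t0 < 1 / 2")
        case False
        then show ?thesis by (simp add: \<Phi>_infinite)
      next
        case True
        have \<tau>1: "\<tau>1 = w * sqrt \<tau>0"
          using pos by (simp add: w powr_minus powr_half_sqrt field_simps)
        define u where "u = 1 - 2 * t0"
        have u: "u > 0" using True by (simp add: u_def)
        define s0 where "s0 = (1 - u / \<tau>0) / 2"
        define s1 where "s1 = t1 / sqrt \<tau>0"
        have s0: "s0 < 1 / 2" and u': "1 - 2 * s0 = u / \<tau>0" using u pos by (auto simp: s0_def field_simps)
        have eq: "s1\<^sup>2 / (2 * (1 - 2 * s0)) = t1\<^sup>2 / (2 * (1 - 2 * t0))"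
          unfolding u' using pos u by (simp add: s1_def u_def[symmetric] power_divide)
        define X where "X = (\<integral>\<^sup>+ x. indicator UNIV x * ennreal (exp (t1\<^sup>2 / (2 * (1 - 2 * t0)) * x\<^sup>2)) \<partial>\<gamma>)"
        have t: "slice_mgf \<gamma> UNIV t0 t1 = ennreal (1 / sqrt u) * X"
          unfolding X_def using slice_mgf_eq[OF True, of UNIV] by (simp add: u_def)
        have s: "slice_mgf \<gamma> UNIV s0 s1 = ennreal (1 / sqrt (u / \<tau>0)) * X"
          unfolding X_def eq[symmetric] u'[symmetric] using slice_mgf_eq[OF s0, of UNIV] by simp
        have exponent: "s0 * \<tau>0 + s1 * \<tau>1 = (\<tau>0 - u) / 2 + t1 * w"
          using pos by (simp add: s0_def s1_def \<tau>1 field_simps)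
        \<comment> \<open>For finite positive \<open>X\<close> the two sides differ by exactly
          \<open>(\<tau>0 - 1 - ln \<tau>0) / 2 >= 0\<close>. If \<open>X\<close> is infinite the
          left side is minus infinity, and if \<open>X = 0\<close> the right side is
          infinite.\<close>
        have "ereal (t0 * 1 + t1 * w) - \<Phi> \<gamma> (t0, t1) \<le> ereal (s0 * \<tau>0 + s1 * \<tau>1) - \<Phi> \<gamma> (s0, s1)"
        proof (cases X)
          case top
          then show ?thesis using u
            by (simp add: \<Phi>_eq_slice_mgf t log_ennreal_def ennreal_mult_eq_top_iff)
        next
          case (real x)
          show ?thesis
          proof (cases "x = 0")
            case True
            then show ?thesis using real by (simp add: \<Phi>_eq_slice_mgf s t log_ennreal_def)
          next
            case False
            then have x: "x > 0" using real by simp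
            have "\<Phi> \<gamma> (t0, t1) = ereal (ln x - ln u / 2)"
              using x u real by (simp add: \<Phi>_eq_slice_mgf t log_ennreal_def ennreal_mult[symmetric] ln_div ln_sqrt)
            moreover have "\<Phi> \<gamma> (s0, s1) = ereal (ln x - (ln u - ln \<tau>0) / 2)"
              using x u pos real by (simp add: \<Phi>_eq_slice_mgf s log_ennreal_def ennreal_mult[symmetric] ln_div ln_sqrt)
            moreover have "ln \<tau>0 \<le> \<tau>0 - 1" using pos by (rule ln_le_minus_one)
            ultimately show ?thesis unfolding exponent by (simp add: u_def field_simps)
          qed
        qed
        also have "\<dots> \<le> legendre (\<Phi> \<gamma>) (\<tau>0, \<tau>1)" by (rule legendre_upper)
        finally show ?thesis .
      qed
    qed
  qed
qed

lemma \<Phi>_zero: "\<Phi> \<gamma> (0, 0) = 0"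
  using prob_space.emeasure_space_1[OF prob_space_std_normal]
  by (simp add: \<Phi>_def log_ennreal_def emeasure_space_1[unfolded space_\<gamma>])

lemma I_an_nonneg: "0 \<le> I_an \<gamma> w"
  using legendre_upper[of 0 1 0 w "\<Phi> \<gamma>"] by (simp add: I_an_eq \<Phi>_zero zero_ereal_def[symmetric])

text \<open>A supremum of affine functions of \<open>w\<close> has level sets that are intersections
  of half-lines (or of the whole line and the empty set), which gives closedness and convexity
  together.\<close>

lemma I_an_level:
  "{w. I_an \<gamma> w \<le> ereal c} = (\<Inter>(t0, t1). {w. ereal (t0 + t1 * w) - \<Phi> \<gamma> (t0, t1) \<le> ereal c})"
  by (auto simp: I_an_eq legendre_le_iff)

lemma affine_level:
  fixes p :: ereal
  shows "closed {w. ereal (a + b * w) - p \<le> ereal c} \<and> convex {w. ereal (a + b * w) - p \<le> ereal c}"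
proof (cases p)
  case (real r)
  have "{w. ereal (a + b * w) - p \<le> ereal c} = {w. b \<bullet> w \<le> c + r - a}"
    using real by (auto simp: algebra_simps)
  then show ?thesis using closed_halfspace_le[of b "c + r - a"] convex_halfspace_le[of b "c + r - a"] by simp
qed auto

lemma closed_I_an_level: "closed {w. I_an \<gamma> w \<le> ereal c}"
  unfolding I_an_level using affine_level by (intro closed_INT ballI) auto

lemma convex_I_an_level: "convex {w. I_an \<gamma> w \<le> ereal c}"
  unfolding I_an_level using affine_level by (intro convex_INT) auto

text \<open>Symmetry of \<open>z\<close> suffices, whether or not \<open>\<gamma>\<close> is
  symmetric: the closed form contains \<open>t1\<close> only as a square.\<close>

lemma \<Phi>_even: "\<Phi> \<gamma> (t0, - t1) = \<Phi> \<gamma> (t0, t1)"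
proof (cases "t0 < 1 / 2")
  case True
  then show ?thesis by (simp add: \<Phi>_eq_slice_mgf slice_mgf_eq)
qed (simp add: \<Phi>_infinite)

text \<open>Integrating over \<open>x\<close> first, the growth bound yields
  \<open>exp (C t^2 z^2 + C)\<close>, which is Gaussian-integrable when
  \<open>C t^2 < 1/2\<close>.\<close>

lemma T2_finite:
  assumes "class_T2 \<gamma>"
  shows "\<exists>t>0. \<Phi> \<gamma> (0, t) < \<infinity>"
proof -
  obtain C where C: "\<And>t. log_ennreal (\<integral>\<^sup>+ y. ennreal (exp (t * y)) \<partial>\<gamma>) < ereal (C * \<bar>t\<bar>\<^sup>2 + C)"
    using assms unfolding class_T2_def by blast
  have C0: "C > 0" using C[of 0] by (simp add: log_ennreal_def emeasure_space_1[unfolded space_\<gamma>])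
  have bound: "(\<integral>\<^sup>+ y. ennreal (exp (t * y)) \<partial>\<gamma>) \<le> ennreal (exp (C * t\<^sup>2 + C))" for t
    using C[of t] by (simp add: log_ennreal_le_iff[symmetric] less_imp_le)
  \<comment> \<open>Chosen to make \<open>C * t^2 = 1/4\<close>, safely below the critical value
    1/2.\<close>
  define t where "t = 1 / (2 * sqrt C)"
  have t: "t > 0" "C * t\<^sup>2 = 1 / 4" using C0 by (auto simp: t_def power_mult_distrib power_divide)
  interpret Z: prob_space std_normal_distribution by (rule prob_space_std_normal)
  interpret P: pair_sigma_finite \<gamma> std_normal_distribution ..
  have "slice_mgf \<gamma> UNIV 0 t = (\<integral>\<^sup>+ x. \<integral>\<^sup>+ z. ennreal (exp (t * z * x)) \<partial>std_normal_distribution \<partial>\<gamma>)"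
    by (simp add: slice_mgf_def)
  also have "\<dots> = (\<integral>\<^sup>+ z. \<integral>\<^sup>+ x. ennreal (exp (t * z * x)) \<partial>\<gamma> \<partial>std_normal_distribution)"
    by (rule P.Fubini'[symmetric]) measurable
  also have "\<dots> \<le> (\<integral>\<^sup>+ z. ennreal (exp C) * ennreal (exp (1 / 4 * z\<^sup>2 + 0 * z)) \<partial>std_normal_distribution)"
  proof (rule nn_integral_mono)
    fix z
    have "C * (t * z)\<^sup>2 + C = C + (1 / 4 * z\<^sup>2 + 0 * z)" using t(2) by (simp add: power_mult_distrib)
    then have "exp (C * (t * z)\<^sup>2 + C) = exp C * exp (1 / 4 * z\<^sup>2 + 0 * z)" by (simp only: exp_add)
    then show "(\<integral>\<^sup>+ x. ennreal (exp (t * z * x)) \<partial>\<gamma>) \<le> ennreal (exp C) * ennreal (exp (1 / 4 * z\<^sup>2 + 0 * z))"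
      using bound[of "t * z"] by (simp add: ennreal_mult[symmetric])
  qed
  also have "\<dots> < \<infinity>"
    using nn_integral_gauss_quadratic[of "1/4" 0]
    by (subst nn_integral_cmult) (auto simp: ennreal_mult_less_top)
  finally have "\<Phi> \<gamma> (0, t) < \<infinity>" by (auto simp: \<Phi>_eq_slice_mgf log_ennreal_def)
  then show ?thesis using t by blast
qed

text \<open>Testing the supremum at \<open>(0, t)\<close> and \<open>(0, - t)\<close> gives the
  linear growth \<open>t |w| - \<Phi> \<gamma> (0, t) <= I_an \<gamma> w\<close>.\<close>

lemma good_I_an:
  assumes "class_T2 \<gamma>"
  shows "good_rate (I_an \<gamma>)"
  unfolding good_rate_def compact_eq_bounded_closed
proof (intro allI conjI closed_I_an_level)
  fix c :: real
  obtain t where t: "t > 0" "\<Phi> \<gamma> (0, t) < \<infinity>" using T2_finite[OF assms] by blast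
  show "bounded {w. I_an \<gamma> w \<le> ereal c}"
  proof (cases "\<Phi> \<gamma> (0, t)")
    case (real p)
    have "\<bar>w\<bar> \<le> (c + p) / t" if "I_an \<gamma> w \<le> ereal c" for w
    proof -
      have "ereal (0 * 1 + t * w) - \<Phi> \<gamma> (0, t) \<le> ereal c" "ereal (0 * 1 + - t * w) - \<Phi> \<gamma> (0, - t) \<le> ereal c"
        using that unfolding I_an_eq legendre_le_iff by blast+
      then show ?thesis using real t(1) by (simp add: \<Phi>_even field_simps abs_le_iff)
    qed
    then show ?thesis by (auto simp: bounded_iff)
  next
    case MInf
    then have "{w. I_an \<gamma> w \<le> ereal c} = {}"
      using legendre_upper[of 0 1 t _ "\<Phi> \<gamma>"] by (force simp: I_an_eq)
    then show ?thesis by simp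
  qed (use t in simp)
qed

lemma quasiconvex_I_an: "quasiconvex (I_an \<gamma>)"
  using I_an_nonneg convex_I_an_level by (auto simp: quasiconvex_def)

lemma lower_semicontinuous_I_an: "lower_semicontinuous (I_an \<gamma>)"
  using closed_I_an_level by (simp add: lower_semicontinuous_def)

subsection \<open>The truncated dual problem\<close>

text \<open>The objective whose supremum over \<open>t0 < 1/2\<close> is the truncated analogue of
  the Legendre transform at \<open>(1, w)\<close>.\<close>

definition dual_gap :: "real \<Rightarrow> real \<Rightarrow> real \<Rightarrow> real \<Rightarrow> real" where
  "dual_gap m w t0 t1 = t0 + t1 * w - trunc_lmgf m t0 t1"

text \<open>Existence is enough: at a maximiser of \<open>dual_gap\<close> the two values are
  forced.\<close>

lemma DERIV_trunc_lmgf: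
  assumes p: "measure \<gamma> {-m..m} > 0" and t0: "t0 < 1 / 2"
  shows "\<exists>a. ((\<lambda>s. trunc_lmgf m s t1) has_real_derivative a) (at t0)"
    and "\<exists>b. ((\<lambda>s. trunc_lmgf m t0 s) has_real_derivative b) (at t1)"
proof -
  have pos: "trunc_mgf \<gamma> m s / sqrt (1 - 2 * t0) > 0" for s
    using trunc_mgf_pos[OF p] t0 by simp
  have ne: "sqrt (1 - 2 * t0) \<noteq> 0" using t0 by simp
  have g1: "((\<lambda>s. t1\<^sup>2 / (2 * (1 - 2 * s))) has_real_derivative (4 * t1\<^sup>2 / (2 * (1 - 2 * t0))\<^sup>2)) (at t0)"
    using t0 by (auto intro!: derivative_eq_intros simp: power2_eq_square)
  have k: "((\<lambda>s. sqrt (1 - 2 * s)) has_real_derivative (inverse (sqrt (1 - 2 * t0)) / 2 * (- 2))) (at t0)"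
    using t0 by (auto intro!: derivative_eq_intros)
  show "\<exists>a. ((\<lambda>s. trunc_lmgf m s t1) has_real_derivative a) (at t0)"
    unfolding trunc_lmgf_def
    using DERIV_chain2[OF DERIV_ln[OF pos] DERIV_divide[OF DERIV_chain2[OF DERIV_trunc_mgf g1] k ne]]
    by blast
  have g2: "((\<lambda>s. s\<^sup>2 / (2 * (1 - 2 * t0))) has_real_derivative (2 * t1 / (2 * (1 - 2 * t0)))) (at t1)"
    using t0 by (auto intro!: derivative_eq_intros)
  show "\<exists>b. ((\<lambda>s. trunc_lmgf m t0 s) has_real_derivative b) (at t1)"
    unfolding trunc_lmgf_def
    using DERIV_chain2[OF DERIV_ln[OF pos] DERIV_cdivide[OF DERIV_chain2[OF DERIV_trunc_mgf g2]]]
    by blast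
qed

text \<open>Fermat's rule in each variable, the half-plane being open. Tilting by the maximiser
  therefore has mean exactly \<open>(1, w)\<close>.\<close>

lemma DERIV_trunc_lmgf_at_max:
  assumes p: "measure \<gamma> {-m..m} > 0" and t0: "t0 < 1 / 2"
    and max: "\<And>s0 s1. s0 < 1 / 2 \<Longrightarrow> dual_gap m w s0 s1 \<le> dual_gap m w t0 t1"
  shows "((\<lambda>s. trunc_lmgf m s t1) has_real_derivative 1) (at t0)"
    and "((\<lambda>s. trunc_lmgf m t0 s) has_real_derivative w) (at t1)"
proof -
  obtain a where a: "((\<lambda>s. trunc_lmgf m s t1) has_real_derivative a) (at t0)"
    using DERIV_trunc_lmgf(1)[OF p t0] by blast
  obtain b where b: "((\<lambda>s. trunc_lmgf m t0 s) has_real_derivative b) (at t1)"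
    using DERIV_trunc_lmgf(2)[OF p t0] by blast
  have da: "((\<lambda>s. dual_gap m w s t1) has_real_derivative 1 - a) (at t0)"
    unfolding dual_gap_def using a by (auto intro!: derivative_eq_intros)
  have "1 - a = 0"
    by (rule DERIV_local_max[OF da, of "1 / 2 - t0"]) (use t0 max in \<open>auto simp: abs_less_iff\<close>)
  then show "((\<lambda>s. trunc_lmgf m s t1) has_real_derivative 1) (at t0)" using a by simp
  have db: "((\<lambda>s. dual_gap m w t0 s) has_real_derivative w - b) (at t1)"
    unfolding dual_gap_def using b by (auto intro!: derivative_eq_intros)
  have "w - b = 0"
    by (rule DERIV_local_max[OF db, of 1]) (use t0 max in auto)
  then show "((\<lambda>s. trunc_lmgf m t0 s) has_real_derivative w) (at t1)" using b by simp
qed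

section \<open>Coercivity and maximisers of the truncated dual problem\<close>

lemma continuous_on_dual_gap:
  assumes p: "measure \<gamma> {-m..m} > 0" and K: "K \<subseteq> {t. fst t < 1 / 2}"
  shows "continuous_on K (\<lambda>t. dual_gap m w (fst t) (snd t))"
proof -
  have tm: "continuous_on UNIV (trunc_mgf \<gamma> m)"
    using DERIV_trunc_mgf by (intro continuous_at_imp_continuous_on ballI DERIV_isCont)
  have "continuous_on K (\<lambda>t. trunc_mgf \<gamma> m ((snd t)\<^sup>2 / (2 * (1 - 2 * fst t))))"
    by (rule continuous_on_compose2[OF tm]) (use K in \<open>auto intro!: continuous_intros\<close>)
  moreover have "trunc_mgf \<gamma> m s \<noteq> 0" for s using trunc_mgf_pos[OF p, of s] by simp
  ultimately show ?thesis
    unfolding dual_gap_def trunc_lmgf_def using K by (intro continuous_intros) auto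
qed

text \<open>A larger window has a larger generating function. Hence a compact set that contains the
  nonnegative superlevel set for one window does so for all larger ones.\<close>

lemma dual_gap_antimono:
  assumes p: "measure \<gamma> {-m..m} > 0" and "m \<le> m'" "t0 < 1 / 2"
  shows "dual_gap m' w t0 t1 \<le> dual_gap m w t0 t1"
proof -
  define s where "s = t1\<^sup>2 / (2 * (1 - 2 * t0))"
  have "0 < trunc_mgf \<gamma> m s" "trunc_mgf \<gamma> m s \<le> trunc_mgf \<gamma> m' s"
    by (rule trunc_mgf_pos[OF p], rule trunc_mgf_mono[OF assms(2)])
  then have "ln (trunc_mgf \<gamma> m s / sqrt (1 - 2 * t0)) \<le> ln (trunc_mgf \<gamma> m' s / sqrt (1 - 2 * t0))"
    using assms(3) by (intro ln_mono divide_right_mono) auto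
  then show ?thesis unfolding dual_gap_def trunc_lmgf_def s_def by simp
qed

text \<open>\<open>trunc_mgf_ge\<close> yields the loss \<open>s v\<close> with
  \<open>s = t1^2 / (2 u)\<close>, \<open>u = 1 - 2 t0\<close>, while a completed square bounds
  \<open>t1 w\<close> by \<open>s v' + u w^2 / (2 v')\<close>. For \<open>w^2 < v' < v\<close> the
  bound decreases linearly in both \<open>u\<close> and \<open>s\<close>, up to a logarithm of
  \<open>u\<close>.\<close>

lemma dual_gap_le:
  assumes c: "c > 0" "c \<le> measure \<gamma> {x. x \<in> {-m..m} \<and> v \<le> x\<^sup>2}"
    and v: "0 < v'" and t0: "t0 < 1 / 2"
  shows "dual_gap m w t0 t1 \<le> 1 / 2 - ln c - (1 - w\<^sup>2 / v') * (1 - 2 * t0) / 2 + ln (1 - 2 * t0) / 2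
    - (v - v') * t1\<^sup>2 / (2 * (1 - 2 * t0))"
proof -
  define u where "u = 1 - 2 * t0"
  define s where "s = t1\<^sup>2 / (2 * u)"
  have u: "u > 0" using t0 by (simp add: u_def)
  have s: "s \<ge> 0" using u by (simp add: s_def)
  have "exp (s * v) * c \<le> exp (s * v) * measure \<gamma> {x. x \<in> {-m..m} \<and> v \<le> x\<^sup>2}"
    using c by (intro mult_left_mono) auto
  also have "\<dots> \<le> trunc_mgf \<gamma> m s" by (rule trunc_mgf_ge[OF s])
  finally have le: "exp (s * v) * c \<le> trunc_mgf \<gamma> m s" .
  have pos: "0 < exp (s * v) * c" using c by simp
  have "ln (exp (s * v) * c / sqrt u) \<le> ln (trunc_mgf \<gamma> m s / sqrt u)"
    using le pos u order_less_le_trans[OF pos le] by (intro ln_mono) (auto simp: divide_right_mono)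
  then have "s * v + ln c - ln u / 2 \<le> trunc_lmgf m t0 t1"
    using c u by (simp add: trunc_lmgf_def u_def[symmetric] s_def[symmetric] ln_div ln_mult ln_sqrt)
  moreover have "t1 * w \<le> s * v' + u * (w\<^sup>2 / v') / 2"
  proof -
    have "0 \<le> (v' * t1 - u * w)\<^sup>2 / (2 * u * v')" using u v by simp
    also have "\<dots> = s * v' + u * (w\<^sup>2 / v') / 2 - t1 * w"
      using u v by (simp add: s_def power2_eq_square field_simps)
    finally show ?thesis by simp
  qed
  ultimately have "dual_gap m w t0 t1 \<le> t0 + s * v' + u * (w\<^sup>2 / v') / 2 - (s * v + ln c - ln u / 2)"
    unfolding dual_gap_def by linarith
  also have "\<dots> = 1 / 2 - ln c - (1 - w\<^sup>2 / v') * u / 2 + ln u / 2 - (v - v') * s"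
  proof -
    define q where "q = w\<^sup>2 / v'"
    have "t0 = (1 - u) / 2" by (simp add: u_def)
    then show ?thesis unfolding q_def[symmetric] by (simp only:) (simp add: field_simps)
  qed
  finally show ?thesis by (simp add: s_def u_def)
qed

lemma superlevel_in_compact:
  assumes c: "0 < measure \<gamma> {x. x \<in> {-m..m} \<and> v \<le> x\<^sup>2}" and v: "w\<^sup>2 < v"
  shows "\<exists>K. compact K \<and> K \<subseteq> {t. fst t < 1 / 2} \<and>
    (\<forall>t0 t1. t0 < 1 / 2 \<longrightarrow> 0 \<le> dual_gap m w t0 t1 \<longrightarrow> (t0, t1) \<in> K)"
proof -
  \<comment> \<open>The midpoint of \<open>w^2\<close> and \<open>v\<close> makes both coefficients
    \<open>\<kappa>\<close> and \<open>\<beta>\<close> positive.\<close>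
  define v' where "v' = (w\<^sup>2 + v) / 2"
  have "0 < w\<^sup>2 + v" using v zero_le_power2[of w] by linarith
  then have v': "0 < v'" "w\<^sup>2 < v'" "v' < v" using v by (auto simp: v'_def)
  define \<kappa> where "\<kappa> = 1 - w\<^sup>2 / v'"
  have \<kappa>: "\<kappa> > 0" using v' by (simp add: \<kappa>_def)
  define \<beta> where "\<beta> = v - v'"
  have \<beta>: "\<beta> > 0" using v' by (simp add: \<beta>_def)
  define A where "A = 1 / 2 - ln (measure \<gamma> {x. x \<in> {-m..m} \<and> v \<le> x\<^sup>2})"
  \<comment> \<open>The tangent of the logarithm at \<open>\<kappa> u / 2 = 1\<close> lets half of
    the linear term absorb \<open>ln u / 2\<close>, leaving
    \<open>\<kappa> u / 4 <= A + ln (2 / \<kappa>) / 2\<close>.\<close>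
  define U where "U = 4 * (A + ln (2 / \<kappa>) / 2) / \<kappa>"
  define T where "T = 2 * U / \<beta> * (\<bar>A\<bar> + U)"
  have main: "exp (- 2 * A) \<le> 1 - 2 * t0 \<and> 1 - 2 * t0 \<le> U \<and> \<bar>t1\<bar> \<le> sqrt T"
    if t0: "t0 < 1 / 2" and nonneg: "0 \<le> dual_gap m w t0 t1" for t0 t1
  proof -
    define u where "u = 1 - 2 * t0"
    have u: "u > 0" using t0 by (simp add: u_def)
    have gap: "0 \<le> A - \<kappa> * u / 2 + ln u / 2 - \<beta> * t1\<^sup>2 / (2 * u)"
      using order_trans[OF nonneg dual_gap_le[OF c order_refl v'(1) t0]]
      by (simp add: A_def \<kappa>_def \<beta>_def u_def)
    have t1: "0 \<le> \<beta> * t1\<^sup>2 / (2 * u)" using \<beta> u by simp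
    have \<kappa>u: "0 \<le> \<kappa> * u" using \<kappa> u by simp
    have "ln (\<kappa> * u / 2) \<le> \<kappa> * u / 2 - 1" using \<kappa> u by (intro ln_le_minus_one) simp
    then have "ln u \<le> \<kappa> * u / 2 + ln (2 / \<kappa>) - 1" using \<kappa> u by (simp add: ln_div ln_mult)
    then have "\<kappa> * u / 4 \<le> A + ln (2 / \<kappa>) / 2" using gap t1 by linarith
    then have U: "u \<le> U" using \<kappa> by (simp add: U_def field_simps)
    have "- 2 * A \<le> ln u" using gap t1 \<kappa>u by linarith
    then have lo: "exp (- 2 * A) \<le> u" using u by (metis exp_le_cancel_iff exp_ln)
    have "ln u \<le> u - 1" using u by (rule ln_le_minus_one)
    then have "\<beta> * t1\<^sup>2 / (2 * u) \<le> \<bar>A\<bar> + U" using gap \<kappa>u U u by linarith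
    then have "t1\<^sup>2 \<le> 2 * u / \<beta> * (\<bar>A\<bar> + U)" using \<beta> u by (simp add: field_simps)
    also have "\<dots> \<le> T"
      unfolding T_def using U u \<beta> by (intro mult_right_mono divide_right_mono) auto
    finally have "\<bar>t1\<bar> \<le> sqrt T" by (simp add: real_le_rsqrt)
    with U lo show ?thesis by (simp add: u_def)
  qed
  define K where "K = {(1 - U) / 2..(1 - exp (- 2 * A)) / 2} \<times> {- sqrt T..sqrt T}"
  have "compact K" unfolding K_def by (intro compact_Times compact_Icc)
  moreover have "K \<subseteq> {t. fst t < 1 / 2}"
  proof clarify
    fix a b assume "(a, b) \<in> K"
    then have "a \<le> (1 - exp (- 2 * A)) / 2" by (simp add: K_def)
    also have "\<dots> < 1 / 2" by simp
    finally show "fst (a, b) < 1 / 2" by simp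
  qed
  moreover have "(t0, t1) \<in> K" if "t0 < 1 / 2" "0 \<le> dual_gap m w t0 t1" for t0 t1
    using main[OF that] by (simp add: K_def field_simps abs_le_iff)
  ultimately show ?thesis by blast
qed

lemma slice_mgf_SUP: "slice_mgf \<gamma> UNIV t0 t1 = (SUP k::nat. slice_mgf \<gamma> {-real k..real k} t0 t1)"
proof -
  define f where "f x = (\<integral>\<^sup>+ z. ennreal (exp (t0 * z\<^sup>2 + t1 * z * x)) \<partial>std_normal_distribution)" for x
  interpret Z: prob_space std_normal_distribution by (rule prob_space_std_normal)
  have [measurable]: "f \<in> borel_measurable borel" unfolding f_def by measurable
  have "(SUP k::nat. slice_mgf \<gamma> {-real k..real k} t0 t1) =
      (\<integral>\<^sup>+ x. (SUP k::nat. indicator {-real k..real k} x * f x) \<partial>\<gamma>)"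
    unfolding slice_mgf_def f_def[symmetric]
    by (rule nn_integral_monotone_convergence_SUP[symmetric])
      (auto simp: incseq_def le_fun_def indicator_def)
  also have "(\<lambda>x. SUP k::nat. indicator {-real k..real k} x * f x) = (\<lambda>x. indicator UNIV x * f x)"
  proof
    fix x
    obtain k where k: "\<bar>x\<bar> \<le> real k" using real_arch_simple by blast
    show "(SUP k::nat. indicator {-real k..real k} x * f x) = indicator UNIV x * f x"
    proof (rule antisym)
      show "(SUP k::nat. indicator {-real k..real k} x * f x) \<le> indicator UNIV x * f x"
        by (rule SUP_least) (simp add: indicator_def)
      show "indicator UNIV x * f x \<le> (SUP k::nat. indicator {-real k..real k} x * f x)"
        by (rule SUP_upper2[of k]) (use k in \<open>auto simp: indicator_def\<close>)
    qed
  qed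
  finally show ?thesis by (simp add: slice_mgf_def f_def)
qed

lemma near_optimal_degenerate:
  assumes null: "measure \<gamma> {x. w\<^sup>2 < x\<^sup>2} = 0" and I: "I_an \<gamma> w < ereal \<alpha>"
  shows "\<exists>m t0 t1. measure \<gamma> {-m..m} > 0 \<and> t0 < 1 / 2 \<and>
    (\<forall>s0 s1. s0 < 1 / 2 \<longrightarrow> dual_gap m w s0 s1 \<le> dual_gap m w t0 t1) \<and> dual_gap m w t0 t1 \<le> \<alpha>"
proof -
  have AE: "AE x in \<gamma>. x\<^sup>2 \<le> w\<^sup>2"
    using null by (subst AE_iff_measurable[OF _ refl]) (auto simp: emeasure_eq_measure not_le)
  show ?thesis
  proof (cases "w = 0")
    case True
    then have "AE x in \<gamma>. x \<in> {-0..0}" using AE by simp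
    then have one: "measure \<gamma> {-0..0} = 1" by (intro prob_eq_1[THEN iffD2]) auto
    have tm: "trunc_mgf \<gamma> 0 s = 1" for s
    proof -
      have "trunc_mgf \<gamma> 0 s = (\<integral>x. indicator {-0..0} x \<partial>\<gamma>)"
        unfolding trunc_mgf_def by (intro Bochner_Integration.integral_cong) (auto simp: indicator_def)
      then show ?thesis using one by simp
    qed
    have "dual_gap 0 w s0 s1 \<le> dual_gap 0 w 0 0" if "s0 < 1 / 2" for s0 s1
      using ln_le_minus_one[of "1 - 2 * s0"] that
      by (simp add: dual_gap_def trunc_lmgf_def tm True ln_div ln_sqrt)
    moreover have "dual_gap 0 w 0 0 \<le> \<alpha>"
      using order_le_less_trans[OF I_an_nonneg I]
      by (simp add: dual_gap_def trunc_lmgf_def tm)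
    ultimately show ?thesis using one by (intro exI[of _ 0]) auto
  next
    case False
    \<comment> \<open>With \<open>t1 = u / w\<close> the exponent is at most \<open>u / 2\<close>
      almost surely, and \<open>ln u / 2 = \<alpha>\<close> then gives a dual value of at least
      \<open>\<alpha> + 1/2\<close>.\<close>
    define u where "u = exp (2 * \<alpha>)"
    have u: "u > 0" "sqrt u = exp \<alpha>"
      by (auto simp: u_def real_sqrt_unique power2_eq_square exp_add[symmetric])
    define t0 where "t0 = (1 - u) / 2"
    define t1 where "t1 = u / w"
    have t0: "t0 < 1 / 2" and u': "1 - 2 * t0 = u" using u by (auto simp: t0_def field_simps)
    have "t1\<^sup>2 / (2 * u) * w\<^sup>2 = u / 2" using False u by (simp add: t1_def power2_eq_square)
    then have le: "t1\<^sup>2 / (2 * u) * x\<^sup>2 \<le> u / 2" if "x\<^sup>2 \<le> w\<^sup>2" for x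
      using mult_left_mono[OF that, of "t1\<^sup>2 / (2 * u)"] u by simp
    have "(\<integral>\<^sup>+ x. indicator UNIV x * ennreal (exp (t1\<^sup>2 / (2 * u) * x\<^sup>2)) \<partial>\<gamma>) \<le>
        (\<integral>\<^sup>+ x. ennreal (exp (u / 2)) \<partial>\<gamma>)"
    proof (rule nn_integral_mono_AE)
      show "AE x in \<gamma>. indicator UNIV x * ennreal (exp (t1\<^sup>2 / (2 * u) * x\<^sup>2)) \<le> ennreal (exp (u / 2))"
        using AE
      proof eventually_elim
        case (elim x)
        have "ennreal (exp (t1\<^sup>2 / (2 * u) * x\<^sup>2)) \<le> ennreal (exp (u / 2))"
          by (intro ennreal_leI exp_le_cancel_iff[THEN iffD2] le elim)
        then show ?case by simp
      qed
    qed
    also have "\<dots> = ennreal (exp (u / 2))" by (simp add: emeasure_space_1[unfolded space_\<gamma>])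
    finally have "slice_mgf \<gamma> UNIV t0 t1 \<le> ennreal (1 / exp \<alpha>) * ennreal (exp (u / 2))"
      using slice_mgf_eq[OF t0, of UNIV t1] unfolding u' u(2) by (simp add: mult_left_mono)
    then have "slice_mgf \<gamma> UNIV t0 t1 \<le> ennreal (exp (u / 2 - \<alpha>))"
      by (simp add: ennreal_mult[symmetric] exp_diff)
    then have "\<Phi> \<gamma> (t0, t1) \<le> ereal (u / 2 - \<alpha>)" by (simp add: \<Phi>_eq_slice_mgf log_ennreal_le_iff)
    then have "ereal (t0 * 1 + t1 * w) - ereal (u / 2 - \<alpha>) \<le> ereal (t0 * 1 + t1 * w) - \<Phi> \<gamma> (t0, t1)"
      by (intro ereal_minus_mono order_refl)
    also have "\<dots> \<le> I_an \<gamma> w" unfolding I_an_eq by (rule legendre_upper)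
    also note I
    finally have "t0 + t1 * w - (u / 2 - \<alpha>) < \<alpha>" by simp
    then show ?thesis using False by (simp add: t0_def t1_def field_simps)
  qed
qed

text \<open>Compactness of the superlevel sets lets a limit point of the maximisers for the truncated laws
  play the role of a dual certificate for the full law.\<close>

lemma near_optimal:
  assumes I: "I_an \<gamma> w < ereal \<alpha>"
  shows "\<exists>m t0 t1. measure \<gamma> {-m..m} > 0 \<and> t0 < 1 / 2 \<and>
    (\<forall>s0 s1. s0 < 1 / 2 \<longrightarrow> dual_gap m w s0 s1 \<le> dual_gap m w t0 t1) \<and> dual_gap m w t0 t1 \<le> \<alpha>"
proof (cases "measure \<gamma> {x. w\<^sup>2 < x\<^sup>2} = 0")
  case True
  then show ?thesis using I by (rule near_optimal_degenerate)
next
  case False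
  \<comment> \<open>One index controls both the window and the slack \<open>1 / (k + 1)\<close>,
    which provides the \<open>v > w^2\<close> needed for coercivity; the sets cover
    \<open>{x. w^2 < x^2}\<close>.\<close>
  define S where "S k = {x. x \<in> {-real k..real k} \<and> w\<^sup>2 + 1 / (real k + 1) \<le> x\<^sup>2}" for k :: nat
  have [measurable]: "S k \<in> sets borel" for k unfolding S_def by measurable
  have "\<exists>m0. 0 < measure \<gamma> (S m0)"
  proof (rule ccontr)
    assume "\<not> ?thesis"
    then have "measure \<gamma> (S k) = 0" for k by (simp add: zero_less_measure_iff)
    then have "\<And>k. S k \<in> null_sets \<gamma>"
      by (intro null_setsI) (simp_all add: emeasure_eq_measure)
    then have "(\<Union>k. S k) \<in> null_sets \<gamma>" by (rule null_sets_UN)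
    moreover have "{x. w\<^sup>2 < x\<^sup>2} \<subseteq> (\<Union>k. S k)"
    proof clarify
      fix x :: real assume x: "w\<^sup>2 < x\<^sup>2"
      obtain k1 where k1: "\<bar>x\<bar> \<le> real k1" using real_arch_simple by blast
      obtain k2 where k2: "1 / (x\<^sup>2 - w\<^sup>2) \<le> real k2" using real_arch_simple by blast
      define k where "k = max k1 k2"
      have k: "\<bar>x\<bar> \<le> real k" "1 / (x\<^sup>2 - w\<^sup>2) \<le> real k + 1" using k1 k2 by (auto simp: k_def)
      then have "1 / (real k + 1) \<le> x\<^sup>2 - w\<^sup>2" using x by (simp add: field_simps)
      then show "x \<in> (\<Union>k. S k)" using k by (auto simp: S_def intro!: exI[of _ k])
    qed
    ultimately have "{x. w\<^sup>2 < x\<^sup>2} \<in> null_sets \<gamma>" by (auto intro: null_sets_subset)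
    then show False using False by (simp add: null_sets_def emeasure_eq_measure)
  qed
  then obtain m0 where m0: "0 < measure \<gamma> (S m0)" by blast
  obtain K where K: "compact K" "K \<subseteq> {t. fst t < 1 / 2}"
    "\<And>t0 t1. t0 < 1 / 2 \<Longrightarrow> 0 \<le> dual_gap (real m0) w t0 t1 \<Longrightarrow> (t0, t1) \<in> K"
    using superlevel_in_compact[of "real m0" "w\<^sup>2 + 1 / (real m0 + 1)" w] m0 unfolding S_def by auto
  have p: "0 < measure \<gamma> {-real m..real m}" if "m0 \<le> m" for m
  proof -
    have "measure \<gamma> (S m0) \<le> measure \<gamma> {-real m..real m}"
      using that by (intro finite_measure_mono) (auto simp: S_def)
    then show ?thesis using m0 by linarith
  qed
  have gap0: "0 \<le> dual_gap (real m) w 0 0" if "m0 \<le> m" for m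
    using p[OF that] by (simp add: dual_gap_def trunc_lmgf_def trunc_mgf_zero)
  have "\<exists>t\<in>K. \<forall>s\<in>K. dual_gap (real m) w (fst s) (snd s) \<le> dual_gap (real m) w (fst t) (snd t)" if "m0 \<le> m" for m
  proof (rule continuous_attains_sup[OF K(1)])
    show "K \<noteq> {}" using K(3)[of 0 0] gap0[of m0] by auto
    show "continuous_on K (\<lambda>t. dual_gap (real m) w (fst t) (snd t))"
      by (rule continuous_on_dual_gap[OF p[OF that] K(2)])
  qed
  then obtain T where T: "\<And>m. m0 \<le> m \<Longrightarrow> T m \<in> K"
    "\<And>m s. m0 \<le> m \<Longrightarrow> s \<in> K \<Longrightarrow> dual_gap (real m) w (fst s) (snd s) \<le> dual_gap (real m) w (fst (T m)) (snd (T m))"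
    by metis
  \<comment> \<open>Outside \<open>K\<close> the gap is negative for \<open>m0\<close> and hence for
    \<open>m\<close>, whereas at the origin it equals minus the logarithm of the window's mass and
    is nonnegative. So the maximum over \<open>K\<close> is global.\<close>
  have max: "dual_gap (real m) w s0 s1 \<le> dual_gap (real m) w (fst (T m)) (snd (T m))" if m: "m0 \<le> m" and s0: "s0 < 1 / 2" for m s0 s1
  proof (cases "(s0, s1) \<in> K")
    case True
    then show ?thesis using T(2)[OF m] by force
  next
    case False
    then have "dual_gap (real m0) w s0 s1 < 0" using K(3)[OF s0, of s1] not_le by blast
    then have "dual_gap (real m) w s0 s1 < 0"
      using dual_gap_antimono[OF p[OF order_refl], of "real m" s0 w s1] m s0 by simp
    also have "0 \<le> dual_gap (real m) w 0 0" by (rule gap0[OF m])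
    also have "\<dots> \<le> dual_gap (real m) w (fst (T m)) (snd (T m))"
      using T(2)[OF m, of "(0, 0)"] K(3)[of 0 0] gap0[of m0] by simp
    finally show ?thesis by simp
  qed
  show ?thesis
  proof (rule ccontr)
    assume contra: "\<not> ?thesis"
    have big: "\<alpha> < dual_gap (real m) w (fst (T m)) (snd (T m))" if m: "m0 \<le> m" for m
    proof (rule ccontr)
      assume "\<not> ?thesis"
      then have "dual_gap (real m) w (fst (T m)) (snd (T m)) \<le> \<alpha>" by simp
      moreover have "fst (T m) < 1 / 2" using T(1)[OF m] K(2) by auto
      moreover note p[OF m] max[OF m]
      ultimately show False using contra by blast
    qed
    have "\<forall>i. T (m0 + i) \<in> K" using T(1) by simp
    then obtain t r where t: "t \<in> K" and r: "strict_mono (r :: nat \<Rightarrow> nat)"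
      and lim: "((\<lambda>i. T (m0 + i)) \<circ> r) \<longlonglongrightarrow> t"
      using K(1) unfolding compact_def by meson
    have t0: "fst t < 1 / 2" using t K(2) by auto
    \<comment> \<open>For fixed \<open>m\<close> and \<open>i >= m\<close> the window
      \<open>m0 + r i\<close> contains that of \<open>m\<close>, so the gap for \<open>m\<close> at
      the maximiser of the larger window still exceeds \<open>\<alpha>\<close>; continuity passes
      this to the limit point.\<close>
    have ge: "\<alpha> \<le> dual_gap (real m) w (fst t) (snd t)" if m: "m0 \<le> m" for m
    proof (rule LIMSEQ_le_const)
      show "(\<lambda>i. dual_gap (real m) w (fst (T (m0 + r i))) (snd (T (m0 + r i)))) \<longlonglongrightarrow> dual_gap (real m) w (fst t) (snd t)"
        using continuous_on_tendsto_compose[OF continuous_on_dual_gap[OF p[OF m] K(2), of w] lim t] T(1)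
        by (simp add: o_def)
      have "\<alpha> \<le> dual_gap (real m) w (fst (T (m0 + r i))) (snd (T (m0 + r i)))" if i: "m \<le> i" for i
      proof -
        have "m \<le> m0 + r i" using i seq_suble[OF r, of i] by linarith
        then show ?thesis
          using big[of "m0 + r i"] dual_gap_antimono[OF p[OF m], of "real (m0 + r i)" "fst (T (m0 + r i))" w "snd (T (m0 + r i))"]
            T(1)[of "m0 + r i"] K(2) by force
      qed
      then show "\<exists>N. \<forall>i\<ge>N. \<alpha> \<le> dual_gap (real m) w (fst (T (m0 + r i))) (snd (T (m0 + r i)))" by blast
    qed
    \<comment> \<open>The bound on the gap is uniform over windows, so monotone convergence carries
      it to the full law and the dual value at \<open>t\<close> is at least
      \<open>\<alpha>\<close>.\<close>
    have "slice_mgf \<gamma> {-real k..real k} (fst t) (snd t) \<le> ennreal (exp (fst t + snd t * w - \<alpha>))" for k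
    proof -
      have "slice_mgf \<gamma> {-real k..real k} (fst t) (snd t) \<le> slice_mgf \<gamma> {-real (max m0 k)..real (max m0 k)} (fst t) (snd t)"
        unfolding slice_mgf_def by (intro nn_integral_mono mult_right_mono) (auto simp: indicator_def)
      also have "\<dots> = ennreal (exp (trunc_lmgf (real (max m0 k)) (fst t) (snd t)))"
        by (rule slice_mgf_trunc[OF t0 p]) simp
      also have "\<dots> \<le> ennreal (exp (fst t + snd t * w - \<alpha>))"
        using ge[of "max m0 k"] by (intro ennreal_leI) (simp add: dual_gap_def)
      finally show ?thesis .
    qed
    then have "slice_mgf \<gamma> UNIV (fst t) (snd t) \<le> ennreal (exp (fst t + snd t * w - \<alpha>))"
      unfolding slice_mgf_SUP by (intro SUP_least)
    then have "\<Phi> \<gamma> (fst t, snd t) \<le> ereal (fst t + snd t * w - \<alpha>)"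
      by (simp only: \<Phi>_eq_slice_mgf log_ennreal_le_iff)
    then have "ereal (fst t * 1 + snd t * w) - ereal (fst t + snd t * w - \<alpha>) \<le> ereal (fst t * 1 + snd t * w) - \<Phi> \<gamma> (fst t, snd t)"
      by (intro ereal_minus_mono order_refl)
    also have "\<dots> \<le> I_an \<gamma> w" unfolding I_an_eq by (rule legendre_upper)
    also note I
    finally show False by simp
  qed
qed

end

subsection \<open>Large deviation bounds\<close>

lemma isCont_real_ball:
  fixes f :: "real \<Rightarrow> real"
  assumes "isCont f x" "\<epsilon> > 0"
  shows "\<exists>\<delta>>0. \<forall>y. \<bar>y - x\<bar> < \<delta> \<longrightarrow> \<bar>f y - f x\<bar> < \<epsilon>"
  using assms unfolding continuous_at_eps_delta dist_real_def by blast

text \<open>Since \<open>W\<close> is the rescaled projection divided by the root of the normalised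
  squared radius, this turns concentration of the pair at \<open>(1, w)\<close> into
  \<open>W\<close> being near \<open>w\<close>.\<close>

lemma quotient_sqrt_near:
  fixes w \<epsilon> :: real
  assumes "\<epsilon> > 0"
  shows "\<exists>\<delta>>0. \<forall>r y. \<bar>r - 1\<bar> < \<delta> \<longrightarrow> \<bar>y - w\<bar> < \<delta> \<longrightarrow> r > 0 \<and> \<bar>y / sqrt r - w\<bar> < \<epsilon>"
proof -
  have "isCont (\<lambda>p. snd p / sqrt (fst p)) (1, w)"
    by (intro continuous_intros) auto
  then obtain d where d: "d > 0" "\<And>p. dist p (1, w) < d \<Longrightarrow> dist (snd p / sqrt (fst p)) w < \<epsilon>"
    using assms unfolding continuous_at_eps_delta by fastforce
  define \<delta> where "\<delta> = min (d / 2) (1 / 2)"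
  have "r > 0 \<and> \<bar>y / sqrt r - w\<bar> < \<epsilon>" if "\<bar>r - 1\<bar> < \<delta>" "\<bar>y - w\<bar> < \<delta>" for r y
  proof -
    have "dist (r, y) (1, w) \<le> \<bar>r - 1\<bar> + \<bar>y - w\<bar>"
      using sqrt_sum_squares_le_sum_abs[of "r - 1" "y - w"] by (simp add: dist_Pair_Pair dist_real_def)
    also have "\<dots> < d" using that by (simp add: \<delta>_def)
    finally have "\<bar>y / sqrt r - w\<bar> < \<epsilon>" using d(2)[of "(r, y)"] by (simp add: dist_real_def)
    moreover have "\<bar>r - 1\<bar> < 1 / 2" using that(1) by (simp add: \<delta>_def)
    then have "r > 0" by linarith
    ultimately show ?thesis by simp
  qed
  moreover have "\<delta> > 0" using d by (simp add: \<delta>_def)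
  ultimately show ?thesis by blast
qed

text \<open>\<open>tilted_lower_bound\<close> with zero tilt and a dummy second coordinate:
  \<open>- ln (1 - 2 s) / 2\<close> has derivative 1 at 0. A subexponential lower bound is all that
  dividing out the radius requires.\<close>

lemma gauss_vec_concentration:
  assumes "\<delta> > 0" "\<eta> > 0"
  shows "\<forall>\<^sub>F n in sequentially. ennreal (exp (- real n * \<eta>)) \<le>
    emeasure (gauss_vec n) {g \<in> space (gauss_vec n). \<bar>(\<Sum>i=1..n. (g i)\<^sup>2) / real n - 1\<bar> < \<delta>}"
proof -
  interpret Z: prob_space std_normal_distribution by (rule prob_space_std_normal)
  interpret Q: product_sigma_finite "\<lambda>_::nat. std_normal_distribution" ..
  have [measurable_cong]: "sets (gauss_vec n) = sets (Rn n)" for n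
    by (intro sets_PiM_cong) auto
  have mgf: "(\<integral>\<^sup>+ g. ennreal (exp (real n * (s0 * ((\<Sum>i=1..n. (g i)\<^sup>2) / real n) + s1 * 0))) \<partial>gauss_vec n) =
      ennreal (exp (real n * (- ln (1 - 2 * s0) / 2)))"
    if n: "n \<ge> 1" and s0: "s0 \<in> {..<1 / 2}" for n :: nat and s0 s1 :: real
  proof -
    have "(\<integral>\<^sup>+ g. ennreal (exp (real n * (s0 * ((\<Sum>i=1..n. (g i)\<^sup>2) / real n) + s1 * 0))) \<partial>gauss_vec n) =
        (\<integral>\<^sup>+ g. (\<Prod>i=1..n. ennreal (exp (s0 * (g i)\<^sup>2 + 0 * g i))) \<partial>gauss_vec n)"
    proof (rule nn_integral_cong)
      fix g :: "nat \<Rightarrow> real"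
      have "real n * (s0 * ((\<Sum>i=1..n. (g i)\<^sup>2) / real n) + s1 * 0) = s0 * (\<Sum>i=1..n. (g i)\<^sup>2)"
        using n by simp
      also have "\<dots> = (\<Sum>i=1..n. s0 * (g i)\<^sup>2 + 0 * g i)" by (simp add: sum_distrib_left)
      finally show "ennreal (exp (real n * (s0 * ((\<Sum>i=1..n. (g i)\<^sup>2) / real n) + s1 * 0))) =
          (\<Prod>i=1..n. ennreal (exp (s0 * (g i)\<^sup>2 + 0 * g i)))"
        by (simp only: prod_ennreal exp_ge_zero exp_sum[symmetric] finite_atLeastAtMost)
    qed
    also have "\<dots> = (\<Prod>i=1..n. \<integral>\<^sup>+ z. ennreal (exp (s0 * z\<^sup>2 + 0 * z)) \<partial>std_normal_distribution)"
      by (rule Q.product_nn_integral_prod) (simp, measurable)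
    also have "\<dots> = ennreal ((1 / sqrt (1 - 2 * s0)) ^ n)"
      using s0 nn_integral_gauss_quadratic[of s0 0] by (simp add: ennreal_power)
    also have "1 / sqrt (1 - 2 * s0) = exp (- ln (1 - 2 * s0) / 2)"
      using s0 by (simp add: exp_minus ln_sqrt[symmetric] field_simps)
    also have "exp (- ln (1 - 2 * s0) / 2) ^ n = exp (real n * (- ln (1 - 2 * s0) / 2))"
      by (simp add: exp_of_nat_mult[symmetric])
    finally show ?thesis .
  qed
  have "\<forall>\<^sub>F n in sequentially. ennreal (exp (real n * (- ln (1 - 2 * 0) / 2 - 0 * 1 - 0 * 0 - \<eta>))) \<le>
    emeasure (gauss_vec n) {g \<in> space (gauss_vec n). \<bar>(\<Sum>i=1..n. (g i)\<^sup>2) / real n - 1\<bar> < \<delta> \<and> \<bar>0 - 0::real\<bar> < \<delta>}"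
  proof (rule tilted_lower_bound[where D = "{..<1 / 2}" and \<phi> = "\<lambda>s0 s1. - ln (1 - 2 * s0) / 2" and Y = "\<lambda>_ _. 0"])
    show "((\<lambda>s. - ln (1 - 2 * s) / 2) has_real_derivative 1) (at 0)"
      by (auto intro!: derivative_eq_intros)
  qed (use assms mgf in \<open>auto\<close>)
  then show ?thesis using assms by simp
qed

lemma eventually_le_exp:
  assumes "\<eta> > 0"
  shows "\<forall>\<^sub>F n in sequentially. C \<le> exp (real n * \<eta>)"
  using assms by real_asymp

section \<open>Enlargement by a Gaussian vector and the two exponential bounds\<close>

locale spherical_projection = real_prob \<gamma> for \<gamma> +
  fixes M :: "nat \<Rightarrow> 'a measure"
    and X \<Theta> :: "nat \<Rightarrow> 'a \<Rightarrow> nat \<Rightarrow> real"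
    and W :: "nat \<Rightarrow> 'a \<Rightarrow> real"
  assumes prob_M: "n \<ge> 1 \<Longrightarrow> prob_space (M n)"
    and distr_X: "n \<ge> 1 \<Longrightarrow> distr (M n) (Rn n) (X n) = (\<Pi>\<^sub>M i\<in>{1..n}. \<gamma>)"
    and distr_\<Theta>: "n \<ge> 1 \<Longrightarrow> uniform_on_sphere n (distr (M n) (Rn n) (\<Theta> n))"
    and indep: "n \<ge> 1 \<Longrightarrow> prob_space.indep_var (M n) (Rn n) (X n) (Rn n) (\<Theta> n)"
    and W_eq: "n \<ge> 1 \<Longrightarrow> \<omega> \<in> space (M n) \<Longrightarrow>
           W n \<omega> = real n powr (-1/2) * (\<Sum>i=1..n. X n \<omega> i * \<Theta> n \<omega> i)"
begin

lemma measurable_X: "n \<ge> 1 \<Longrightarrow> X n \<in> measurable (M n) (Rn n)"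
  and measurable_\<Theta>: "n \<ge> 1 \<Longrightarrow> \<Theta> n \<in> measurable (M n) (Rn n)"
  using indep[of n] prob_space.indep_var_distribution_eq[OF prob_M[of n]] by auto

lemma measurable_W: "n \<ge> 1 \<Longrightarrow> W n \<in> borel_measurable (M n)"
proof -
  assume n: "n \<ge> 1"
  note [measurable] = measurable_X[OF n] measurable_\<Theta>[OF n]
  have "(\<lambda>\<omega>. real n powr (-1/2) * (\<Sum>i=1..n. X n \<omega> i * \<Theta> n \<omega> i)) \<in> borel_measurable (M n)"
    by measurable
  then show ?thesis using W_eq[OF n] by (simp cong: measurable_cong)
qed

text \<open>The product measure builds in the independence of \<open>g\<close> from \<open>X\<close>
  and \<open>\<Theta>\<close>, hence from \<open>W\<close>.\<close>

abbreviation ext :: "nat \<Rightarrow> ('a \<times> (nat \<Rightarrow> real)) measure" where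
  "ext n \<equiv> M n \<Otimes>\<^sub>M gauss_vec n"

definition sq_norm :: "nat \<Rightarrow> 'a \<times> (nat \<Rightarrow> real) \<Rightarrow> real" where
  "sq_norm n p = (\<Sum>i=1..n. (snd p i)\<^sup>2) / real n"

definition scaled :: "nat \<Rightarrow> 'a \<times> (nat \<Rightarrow> real) \<Rightarrow> real" where
  "scaled n p = sqrt (\<Sum>i=1..n. (snd p i)\<^sup>2) * (\<Sum>i=1..n. X n (fst p) i * \<Theta> n (fst p) i) / real n"

text \<open>The indicator that all n coordinates of \<open>X\<close> lie in \<open>B\<close>, with
  values in \<open>ennreal\<close> so that it can serve as a density.\<close>

definition cut :: "real set \<Rightarrow> nat \<Rightarrow> 'a \<times> (nat \<Rightarrow> real) \<Rightarrow> ennreal" where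
  "cut B n p = (\<Prod>i=1..n. indicator B (X n (fst p) i))"

lemma sets_gauss_vec [measurable_cong]: "sets (gauss_vec n) = sets (Rn n)"
  by (intro sets_PiM_cong) auto

lemma measurable_ext:
  assumes n: "n \<ge> 1"
  shows "sq_norm n \<in> borel_measurable (ext n)" "scaled n \<in> borel_measurable (ext n)"
    and "B \<in> sets borel \<Longrightarrow> cut B n \<in> borel_measurable (ext n)"
proof -
  note [measurable] = measurable_X[OF n] measurable_\<Theta>[OF n]
  show "sq_norm n \<in> borel_measurable (ext n)" "scaled n \<in> borel_measurable (ext n)"
    unfolding sq_norm_def scaled_def by measurable
  assume [measurable]: "B \<in> sets borel"
  show "cut B n \<in> borel_measurable (ext n)" unfolding cut_def by measurable
qed

lemma scaled_eq:
  assumes n: "n \<ge> 1" and p: "fst p \<in> space (M n)"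
  shows "scaled n p = sqrt (sq_norm n p) * W n (fst p)"
proof -
  have "real n powr (-1/2) = 1 / sqrt (real n)"
    using n by (simp add: powr_minus powr_half_sqrt field_simps)
  then have "sqrt (S / real n) * (real n powr (-1/2) * T) = sqrt S * T / (sqrt (real n) * sqrt (real n))" for S T
    by (simp only: real_sqrt_divide) simp
  then show ?thesis
    unfolding scaled_def sq_norm_def W_eq[OF n p] by simp
qed

text \<open>The factor \<open>real n\<close> cancels the normalisation in \<open>sq_norm\<close> and
  \<open>scaled\<close>. Independence makes the joint law of \<open>X\<close> and
  \<open>\<Theta>\<close> a product, so \<open>\<Theta>\<close> can be integrated with
  \<open>X\<close> fixed, as in \<open>joint_mgf\<close>.\<close>

lemma mgf_ext:
  assumes n: "n \<ge> 1" and B: "B \<in> sets borel" and t0: "t0 < 1 / 2"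
  shows "(\<integral>\<^sup>+ p. cut B n p * ennreal (exp (real n * (t0 * sq_norm n p + t1 * scaled n p))) \<partial>ext n) =
    slice_mgf \<gamma> B t0 t1 ^ n"
proof -
  interpret Mn: prob_space "M n" by (rule prob_M[OF n])
  interpret G: prob_space "gauss_vec n" by (rule prob_space_gauss_vec)
  note [measurable] = measurable_X[OF n] measurable_\<Theta>[OF n] measurable_ext[OF n] B measurable_ext(3)[OF n B]
  interpret DX: prob_space "distr (M n) (Rn n) (X n)" by (rule Mn.prob_space_distr) measurable
  interpret DT: prob_space "distr (M n) (Rn n) (\<Theta> n)" by (rule Mn.prob_space_distr) measurable
  define H where "H x \<theta> = (\<integral>\<^sup>+ g. (\<Prod>i=1..n. indicator B (x i)) * ennreal (exp (t0 * (\<Sum>i=1..n. (g i)\<^sup>2) +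
        t1 * (sqrt (\<Sum>i=1..n. (g i)\<^sup>2) * (\<Sum>i=1..n. x i * \<theta> i)))) \<partial>gauss_vec n)" for x \<theta> :: "nat \<Rightarrow> real"
  have H [measurable]: "(\<lambda>p. H (fst p) (snd p)) \<in> borel_measurable (Rn n \<Otimes>\<^sub>M Rn n)"
    unfolding H_def by measurable
  have pair: "distr (M n) (Rn n) (X n) \<Otimes>\<^sub>M distr (M n) (Rn n) (\<Theta> n) =
      distr (M n) (Rn n \<Otimes>\<^sub>M Rn n) (\<lambda>\<omega>. (X n \<omega>, \<Theta> n \<omega>))"
    using indep[OF n] Mn.indep_var_distribution_eq by blast
  have "(\<integral>\<^sup>+ p. cut B n p * ennreal (exp (real n * (t0 * sq_norm n p + t1 * scaled n p))) \<partial>ext n) =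
      (\<integral>\<^sup>+ \<omega>. \<integral>\<^sup>+ g. cut B n (\<omega>, g) * ennreal (exp (real n * (t0 * sq_norm n (\<omega>, g) + t1 * scaled n (\<omega>, g)))) \<partial>gauss_vec n \<partial>M n)"
    by (rule G.nn_integral_fst[symmetric]) measurable
  also have "\<dots> = (\<integral>\<^sup>+ \<omega>. H (X n \<omega>) (\<Theta> n \<omega>) \<partial>M n)"
    using n unfolding H_def cut_def sq_norm_def scaled_def by (simp add: distrib_left)
  also have "\<dots> = (\<integral>\<^sup>+ p. H (fst p) (snd p) \<partial>distr (M n) (Rn n \<Otimes>\<^sub>M Rn n) (\<lambda>\<omega>. (X n \<omega>, \<Theta> n \<omega>)))"
    by (subst nn_integral_distr, measurable, measurable)
  also have "\<dots> = (\<integral>\<^sup>+ x. \<integral>\<^sup>+ \<theta>. H x \<theta> \<partial>distr (M n) (Rn n) (\<Theta> n) \<partial>distr (M n) (Rn n) (X n))"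
  proof -
    have "(\<lambda>p. H (fst p) (snd p)) \<in> borel_measurable (distr (M n) (Rn n) (X n) \<Otimes>\<^sub>M distr (M n) (Rn n) (\<Theta> n))"
      unfolding pair measurable_distr_eq1 by (rule H)
    from DT.nn_integral_fst[OF this] show ?thesis unfolding pair by simp
  qed
  also have "\<dots> = slice_mgf \<gamma> B t0 t1 ^ n"
    unfolding H_def distr_X[OF n]
    by (rule joint_mgf[OF _ sets_\<gamma> B distr_\<Theta>[OF n] t0]) (rule prob_space_axioms)
  finally show ?thesis .
qed

lemma lower_bound:
  assumes I: "I_an \<gamma> w < ereal \<alpha>" and \<epsilon>: "\<epsilon> > 0"
  shows "\<forall>\<^sub>F n in sequentially. ennreal (exp (- real n * \<alpha>)) \<le>
    emeasure (M n) {\<omega> \<in> space (M n). \<bar>W n \<omega> - w\<bar> < \<epsilon>}"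
proof -
  obtain \<beta> where \<beta>: "I_an \<gamma> w < ereal \<beta>" "\<beta> < \<alpha>" using ereal_dense2[OF I] by auto
  obtain m t0 t1 where p: "measure \<gamma> {-m..m} > 0" and t0: "t0 < 1 / 2"
    and max: "\<And>s0 s1. s0 < 1 / 2 \<Longrightarrow> dual_gap m w s0 s1 \<le> dual_gap m w t0 t1"
    and gap: "dual_gap m w t0 t1 \<le> \<beta>"
    using near_optimal[OF \<beta>(1)] by blast
  obtain \<delta> where \<delta>: "\<delta> > 0"
    "\<And>r y. \<bar>r - 1\<bar> < \<delta> \<Longrightarrow> \<bar>y - w\<bar> < \<delta> \<Longrightarrow> r > 0 \<and> \<bar>y / sqrt r - w\<bar> < \<epsilon>"
    using quotient_sqrt_near[OF \<epsilon>] by metis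
  \<comment> \<open>The density is at most 1, so every mass under \<open>Q n\<close> is a lower
    bound for the probability under \<open>ext n\<close>.\<close>
  define Q where "Q n = density (ext n) (cut {-m..m} n)" for n
  have cut [measurable]: "cut {-m..m} n \<in> borel_measurable (ext n)" if "n \<ge> 1" for n
    using measurable_ext(3)[OF that] by simp
  have "\<forall>\<^sub>F n in sequentially. ennreal (exp (real n * (trunc_lmgf m t0 t1 - t0 * 1 - t1 * w - (\<alpha> - \<beta>)))) \<le>
    emeasure (Q n) {p \<in> space (Q n). \<bar>sq_norm n p - 1\<bar> < \<delta> \<and> \<bar>scaled n p - w\<bar> < \<delta>}"
  proof (rule tilted_lower_bound[where D = "{..<1 / 2}" and \<phi> = "trunc_lmgf m"])
    fix n :: nat and s0 s1 :: real
    assume n: "n \<ge> 1" and s0: "s0 \<in> {..<1 / 2}"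
    note [measurable] = measurable_ext(1,2)[OF n] cut[OF n]
    have "(\<integral>\<^sup>+ p. ennreal (exp (real n * (s0 * sq_norm n p + s1 * scaled n p))) \<partial>Q n) =
        (\<integral>\<^sup>+ p. cut {-m..m} n p * ennreal (exp (real n * (s0 * sq_norm n p + s1 * scaled n p))) \<partial>ext n)"
      unfolding Q_def by (rule nn_integral_density) measurable
    also have "\<dots> = slice_mgf \<gamma> {-m..m} s0 s1 ^ n"
      by (rule mgf_ext[OF n]) (use s0 in auto)
    also have "\<dots> = ennreal (exp (real n * trunc_lmgf m s0 s1))"
      using s0 p by (subst slice_mgf_trunc) (auto simp: ennreal_power exp_of_nat_mult)
    finally show "(\<integral>\<^sup>+ p. ennreal (exp (real n * (s0 * sq_norm n p + s1 * scaled n p))) \<partial>Q n) =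
        ennreal (exp (real n * trunc_lmgf m s0 s1))" .
  qed (use t0 \<delta>(1) \<beta>(2) DERIV_trunc_lmgf_at_max[OF p t0 max] measurable_ext(1,2) in \<open>simp_all add: Q_def\<close>)
  then show ?thesis using eventually_ge_at_top[of 1]
  proof eventually_elim
    case (elim n)
    note n = elim(2)
    interpret Mn: prob_space "M n" by (rule prob_M[OF n])
    interpret G: prob_space "gauss_vec n" by (rule prob_space_gauss_vec)
    note [measurable] = measurable_ext(1,2)[OF n] cut[OF n] measurable_W[OF n]
    define E where "E = {p \<in> space (ext n). \<bar>sq_norm n p - 1\<bar> < \<delta> \<and> \<bar>scaled n p - w\<bar> < \<delta>}"
    define A where "A = {\<omega> \<in> space (M n). \<bar>W n \<omega> - w\<bar> < \<epsilon>}"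
    have [measurable]: "E \<in> sets (ext n)" "A \<in> sets (M n)" unfolding E_def A_def by measurable
    \<comment> \<open>By \<open>gap\<close> the exponent without the loss is at least
      \<open>- \<beta>\<close>; the loss \<open>\<alpha> - \<beta>\<close> allowed to the tilting
      brings it to \<open>- \<alpha>\<close> at worst.\<close>
    have "- real n * \<alpha> \<le> real n * (trunc_lmgf m t0 t1 - t0 * 1 - t1 * w - (\<alpha> - \<beta>))"
      using mult_left_mono[OF gap, of "real n"] by (simp add: dual_gap_def algebra_simps)
    then have "ennreal (exp (- real n * \<alpha>)) \<le> ennreal (exp (real n * (trunc_lmgf m t0 t1 - t0 * 1 - t1 * w - (\<alpha> - \<beta>))))"
      by (intro ennreal_leI) simp
    also have "\<dots> \<le> emeasure (Q n) E" using elim(1) by (simp add: Q_def E_def)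
    also have "\<dots> = (\<integral>\<^sup>+ p. cut {-m..m} n p * indicator E p \<partial>ext n)"
      unfolding Q_def by (rule emeasure_density) measurable
    also have "\<dots> \<le> (\<integral>\<^sup>+ p. indicator E p \<partial>ext n)"
    proof (rule nn_integral_mono)
      fix p
      have "cut {-m..m} n p \<le> 1" unfolding cut_def by (intro prod_le_1) (auto simp: indicator_def)
      then show "cut {-m..m} n p * indicator E p \<le> indicator E p" by (simp add: indicator_def)
    qed
    also have "\<dots> = emeasure (ext n) E" by (rule nn_integral_indicator) measurable
    also have "\<dots> \<le> emeasure (ext n) (A \<times> space (gauss_vec n))"
    proof (rule emeasure_mono)
      show "E \<subseteq> A \<times> space (gauss_vec n)"
      proof
        fix p assume p: "p \<in> E"
        then have sp: "fst p \<in> space (M n)" "snd p \<in> space (gauss_vec n)"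
          by (auto simp: E_def space_pair_measure)
        have "sq_norm n p > 0 \<and> \<bar>scaled n p / sqrt (sq_norm n p) - w\<bar> < \<epsilon>"
          using p by (intro \<delta>(2)) (auto simp: E_def)
        then have "\<bar>W n (fst p) - w\<bar> < \<epsilon>" using scaled_eq[OF n sp(1)] by (auto split: if_splits)
        then show "p \<in> A \<times> space (gauss_vec n)" using sp by (cases p) (simp add: A_def)
      qed
    qed measurable
    also have "\<dots> = emeasure (M n) A * emeasure (gauss_vec n) (space (gauss_vec n))"
      by (rule G.emeasure_pair_measure_Times) measurable
    also have "\<dots> = emeasure (M n) A" by (simp only: G.emeasure_space_1 mult_1_right)
    finally show ?case unfolding A_def .
  qed
qed

text \<open>Evenness of \<open>\<Phi>\<close> in \<open>t1\<close> treats both tails at once: slopes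
  \<open>s\<close> and \<open>- s\<close> have the same generating function. Restricting to radii
  near 1 makes the \<open>t0\<close> term essentially constant, whatever its sign.\<close>

lemma upper_bound:
  assumes I: "ereal c < I_an \<gamma> d" and d: "d \<ge> 0"
  shows "\<forall>\<^sub>F n in sequentially. emeasure (M n) {\<omega> \<in> space (M n). d \<le> \<bar>W n \<omega>\<bar>} \<le> ennreal (exp (- real n * c))"
proof -
  obtain t0 t where t: "ereal c < ereal (t0 + t * d) - \<Phi> \<gamma> (t0, t)"
    using I unfolding I_an_eq legendre_def less_SUP_iff by auto
  define s where "s = \<bar>t\<bar>"
  have "\<Phi> \<gamma> (t0, s) = \<Phi> \<gamma> (t0, t)" by (simp add: s_def abs_real_def \<Phi>_even)
  moreover have "t * d \<le> s * d" using d by (simp add: s_def mult_right_mono)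
  ultimately have "ereal c < ereal (t0 + s * d) - \<Phi> \<gamma> (t0, s)"
    using order_less_le_trans[OF t ereal_minus_mono[of "ereal (t0 + t * d)" "ereal (t0 + s * d)"]] by simp
  note gap = this
  then obtain p where p: "\<Phi> \<gamma> (t0, s) \<le> ereal p" "c < t0 + s * d - p"
  proof (cases "\<Phi> \<gamma> (t0, s)")
    case (real r)
    with gap show ?thesis using that[of r] by simp
  next
    case MInf
    then show ?thesis using that[of "t0 + s * d - c - 1"] by simp
  qed simp
  have t0: "t0 < 1 / 2" using p(1) \<Phi>_infinite[of t0 s] by (cases "t0 < 1 / 2") auto
  have s: "s \<ge> 0" by (simp add: s_def)
  have slice: "slice_mgf \<gamma> UNIV t0 s \<le> ennreal (exp p)" "slice_mgf \<gamma> UNIV t0 (- s) \<le> ennreal (exp p)"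
    using p(1) p(1)[folded \<Phi>_even[of t0 s]] by (simp_all only: \<Phi>_eq_slice_mgf log_ennreal_le_iff)
  \<comment> \<open>Three losses of \<open>\<eta>\<close>: the fluctuation of the radius, the
    probability of \<open>N\<close>, and the factor 2 from the two tails.\<close>
  define \<eta> where "\<eta> = (t0 + s * d - p - c) / 3"
  have \<eta>: "\<eta> > 0" using p(2) by (simp add: \<eta>_def)
  obtain \<delta>0 where \<delta>0: "\<delta>0 > 0" "\<And>r. \<bar>r - 1\<bar> < \<delta>0 \<Longrightarrow> \<bar>(t0 * r + s * sqrt r * d) - (t0 * 1 + s * sqrt 1 * d)\<bar> < \<eta>"
  proof -
    have "isCont (\<lambda>r. t0 * r + s * sqrt r * d) 1" by (intro continuous_intros)
    from isCont_real_ball[OF this \<eta>] show ?thesis using that by blast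
  qed
  show ?thesis
    using gauss_vec_concentration[OF \<delta>0(1) \<eta>] eventually_ge_at_top[of 1] eventually_le_exp[OF \<eta>, of 2]
  proof eventually_elim
    case (elim n)
    note n = elim(2)
    interpret Mn: prob_space "M n" by (rule prob_M[OF n])
    interpret G: prob_space "gauss_vec n" by (rule prob_space_gauss_vec)
    note [measurable] = measurable_ext(1,2)[OF n] measurable_W[OF n]
    define A where "A = {\<omega> \<in> space (M n). d \<le> \<bar>W n \<omega>\<bar>}"
    define N where "N = {g \<in> space (gauss_vec n). \<bar>(\<Sum>i=1..n. (g i)\<^sup>2) / real n - 1\<bar> < \<delta>0}"
    have [measurable]: "A \<in> sets (M n)" "N \<in> sets (gauss_vec n)" unfolding A_def N_def by measurable
    \<comment> \<open>On \<open>A \<times> N\<close> the larger of the two Chernoff weights is at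
      least \<open>L\<close>, so their sum dominates \<open>L\<close> there.\<close>
    define L where "L = exp (real n * (t0 + s * d - \<eta>))"
    have "emeasure (ext n) (A \<times> N) = emeasure (M n) A * emeasure (gauss_vec n) N"
      by (rule G.emeasure_pair_measure_Times) measurable
    moreover have "(\<integral>\<^sup>+ p. ennreal L * indicator (A \<times> N) p \<partial>ext n) = ennreal L * emeasure (ext n) (A \<times> N)"
      by (rule nn_integral_cmult_indicator) measurable
    ultimately have "emeasure (M n) A * emeasure (gauss_vec n) N * ennreal L =
        (\<integral>\<^sup>+ p. ennreal L * indicator (A \<times> N) p \<partial>ext n)"
      by (simp only: mult.commute)
    also have "\<dots> \<le> (\<integral>\<^sup>+ p. cut UNIV n p * ennreal (exp (real n * (t0 * sq_norm n p + s * scaled n p))) +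
        cut UNIV n p * ennreal (exp (real n * (t0 * sq_norm n p + (- s) * scaled n p))) \<partial>ext n)"
    proof (rule nn_integral_mono)
      fix p
      show "ennreal L * indicator (A \<times> N) p \<le> cut UNIV n p * ennreal (exp (real n * (t0 * sq_norm n p + s * scaled n p))) +
        cut UNIV n p * ennreal (exp (real n * (t0 * sq_norm n p + (- s) * scaled n p)))"
      proof (cases "p \<in> A \<times> N")
        case True
        then have pA: "fst p \<in> space (M n)" "d \<le> \<bar>W n (fst p)\<bar>" and r: "\<bar>sq_norm n p - 1\<bar> < \<delta>0"
          by (auto simp: A_def N_def sq_norm_def)
        have sq0: "0 \<le> sq_norm n p" by (simp add: sq_norm_def sum_nonneg)
        have "t0 + s * d - \<eta> \<le> t0 * sq_norm n p + s * sqrt (sq_norm n p) * d"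
          using \<delta>0(2)[OF r] by simp
        also have "\<dots> \<le> t0 * sq_norm n p + s * \<bar>scaled n p\<bar>"
          using s sq0 pA(2) unfolding scaled_eq[OF n pA(1)] abs_mult
          by (simp add: mult.assoc mult_left_mono)
        finally have "t0 + s * d - \<eta> \<le> t0 * sq_norm n p + s * \<bar>scaled n p\<bar>" .
        then have "L \<le> exp (real n * (t0 * sq_norm n p + s * \<bar>scaled n p\<bar>))"
          unfolding L_def by (simp add: mult_left_mono)
        also have "\<dots> \<le> exp (real n * (t0 * sq_norm n p + s * scaled n p)) + exp (real n * (t0 * sq_norm n p + (- s) * scaled n p))"
          by (cases "scaled n p \<ge> 0") auto
        finally have "ennreal L \<le> ennreal (exp (real n * (t0 * sq_norm n p + s * scaled n p)) + exp (real n * (t0 * sq_norm n p + (- s) * scaled n p)))"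
          by (rule ennreal_leI)
        then show ?thesis using True by (simp add: cut_def ennreal_plus)
      qed simp
    qed
    also have "\<dots> = slice_mgf \<gamma> UNIV t0 s ^ n + slice_mgf \<gamma> UNIV t0 (- s) ^ n"
    proof -
      have [measurable]: "cut UNIV n \<in> borel_measurable (ext n)" using measurable_ext(3)[OF n] by simp
      show ?thesis
        unfolding mgf_ext[OF n sets.top[of borel, unfolded space_borel] t0, symmetric] by (rule nn_integral_add) measurable
    qed
    also have "\<dots> \<le> ennreal (exp p) ^ n + ennreal (exp p) ^ n"
      by (intro add_mono power_mono slice) auto
    also have "\<dots> = ennreal (2 * exp (real n * p))"
      by (simp add: ennreal_power exp_of_nat_mult[symmetric] ennreal_plus[symmetric] del: ennreal_plus)
    finally have "emeasure (M n) A * emeasure (gauss_vec n) N * ennreal L \<le> ennreal (2 * exp (real n * p))" .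
    moreover have "emeasure (M n) A * ennreal (exp (- real n * \<eta>)) * ennreal L \<le> emeasure (M n) A * emeasure (gauss_vec n) N * ennreal L"
      using elim(1) unfolding N_def by (intro mult_right_mono mult_left_mono) auto
    ultimately have "emeasure (M n) A * ennreal (exp (- real n * \<eta>)) * ennreal L \<le> ennreal (2 * exp (real n * p))"
      by (rule order_trans[rotated])
    then have "measure (M n) A * exp (- real n * \<eta>) * L \<le> 2 * exp (real n * p)"
      by (simp add: Mn.emeasure_eq_measure ennreal_mult[symmetric] L_def)
    also have "\<dots> \<le> exp (real n * \<eta>) * exp (real n * p)" using elim(3) by (intro mult_right_mono) auto
    finally have "measure (M n) A * exp (- real n * \<eta>) * L \<le> exp (real n * \<eta>) * exp (real n * p)" .
    moreover have "exp (- real n * \<eta>) * L = exp (real n * (t0 + s * d - 2 * \<eta>))"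
      by (simp add: L_def exp_add[symmetric] algebra_simps)
    ultimately have "measure (M n) A * exp (real n * (t0 + s * d - 2 * \<eta>)) \<le> exp (real n * (\<eta> + p))"
      by (simp add: mult.assoc exp_add[symmetric] distrib_left)
    then have "measure (M n) A \<le> exp (real n * (\<eta> + p)) / exp (real n * (t0 + s * d - 2 * \<eta>))"
      by (simp add: pos_le_divide_eq)
    also have "\<dots> = exp (real n * (\<eta> + p - (t0 + s * d - 2 * \<eta>)))"
      by (simp add: exp_diff[symmetric] algebra_simps)
    also have "\<eta> + p - (t0 + s * d - 2 * \<eta>) = - c" by (simp add: \<eta>_def field_simps)
    finally show ?case unfolding A_def[symmetric]
      by (simp add: Mn.emeasure_eq_measure ennreal_leI)
  qed
qed

lemma I_an_even: "I_an \<gamma> (- w) = I_an \<gamma> w"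
proof -
  have "I_an \<gamma> (- v) \<le> I_an \<gamma> v" for v
    unfolding I_an_eq legendre_le_iff
  proof (intro allI)
    fix t0 t1
    show "ereal (t0 * 1 + t1 * - v) - \<Phi> \<gamma> (t0, t1) \<le> legendre (\<Phi> \<gamma>) (1, v)"
      using legendre_upper[of t0 1 "- t1" v "\<Phi> \<gamma>"] by (simp add: \<Phi>_even)
  qed
  from this[of w] this[of "- w"] show ?thesis by (simp add: antisym)
qed

lemma LDP: "satisfies_LDP M W real (I_an \<gamma>)"
  unfolding satisfies_LDP_def
proof (intro conjI ballI allI impI)
  fix n :: nat assume "1 \<le> n"
  then show "prob_space (M n)" "W n \<in> borel_measurable (M n)" by (rule prob_M, rule measurable_W)
next
  show "0 \<le> I_an \<gamma> x" for x by (rule I_an_nonneg)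
  show "lower_semicontinuous (I_an \<gamma>)" by (rule lower_semicontinuous_I_an)
next
  fix \<Gamma> :: "real set"
  let ?f = "\<lambda>S n. ereal (1 / real n) * log_ennreal (emeasure (M n) {\<omega> \<in> space (M n). W n \<omega> \<in> S})"
  have meas: "{\<omega> \<in> space (M n). W n \<omega> \<in> S} \<in> sets (M n)" if "n \<ge> 1" "S \<in> sets borel" for n S
    using measurable_W[OF that(1)] that(2) by measurable
  show "- (INF x\<in>interior \<Gamma>. I_an \<gamma> x) \<le> liminf (?f (interior \<Gamma>))"
  proof -
    have "- liminf (?f (interior \<Gamma>)) \<le> I_an \<gamma> w" if w: "w \<in> interior \<Gamma>" for w
    \<comment> \<open>\<open>lower_bound\<close> needs strict inequality; letting \<open>z\<close>
      decrease to the rate recovers it, and an infinite rate leaves nothing to prove.\<close>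
    proof (rule dense_ge)
      fix z assume z: "I_an \<gamma> w < z"
      show "- liminf (?f (interior \<Gamma>)) \<le> z"
      proof (cases z)
        case (real \<alpha>)
        obtain \<epsilon> where \<epsilon>: "\<epsilon> > 0" "ball w \<epsilon> \<subseteq> interior \<Gamma>"
          using w open_contains_ball[of "interior \<Gamma>"] by auto
        have "\<forall>\<^sub>F n in sequentially. ereal (- \<alpha>) \<le> ?f (interior \<Gamma>) n"
          using lower_bound[OF z[unfolded real] \<epsilon>(1)] eventually_ge_at_top[of 1]
        proof eventually_elim
          case (elim n)
          note elim(1)
          also have "emeasure (M n) {\<omega> \<in> space (M n). \<bar>W n \<omega> - w\<bar> < \<epsilon>} \<le> emeasure (M n) {\<omega> \<in> space (M n). W n \<omega> \<in> interior \<Gamma>}"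
            using \<epsilon>(2) by (intro emeasure_mono meas elim) (auto simp: subset_eq dist_real_def abs_minus_commute)
          finally have "ereal (- real n * \<alpha>) \<le> log_ennreal (emeasure (M n) {\<omega> \<in> space (M n). W n \<omega> \<in> interior \<Gamma>})"
            by (simp only: log_ennreal_ge_iff)
          then have "ereal (1 / real n) * ereal (- real n * \<alpha>) \<le> ?f (interior \<Gamma>) n"
            by (intro ereal_mult_left_mono) auto
          then show ?case using elim(2) by simp
        qed
        then have "ereal (- \<alpha>) \<le> liminf (?f (interior \<Gamma>))" by (rule Liminf_bounded)
        then show ?thesis using real by (simp add: ereal_uminus_le_reorder)
      qed (use z in auto)
    qed
    then have "- liminf (?f (interior \<Gamma>)) \<le> (INF x\<in>interior \<Gamma>. I_an \<gamma> x)" by (intro INF_greatest)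
    then show ?thesis by (simp add: ereal_uminus_le_reorder)
  qed
  show "liminf (?f (interior \<Gamma>)) \<le> limsup (?f (closure \<Gamma>))"
  proof -
    have log_mono: "log_ennreal x \<le> log_ennreal y" if "x \<le> y" for x y
    proof (rule ereal_le_real)
      fix z assume "log_ennreal y \<le> ereal z"
      then show "log_ennreal x \<le> ereal z" using that by (simp add: log_ennreal_le_iff)
    qed
    have "\<forall>\<^sub>F n in sequentially. ?f (interior \<Gamma>) n \<le> ?f (closure \<Gamma>) n"
      using eventually_ge_at_top[of 1]
    proof eventually_elim
      case (elim n)
      have "{\<omega> \<in> space (M n). W n \<omega> \<in> interior \<Gamma>} \<subseteq> {\<omega> \<in> space (M n). W n \<omega> \<in> closure \<Gamma>}"
        using interior_subset[of \<Gamma>] closure_subset[of \<Gamma>] by auto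
      then show ?case
        by (intro ereal_mult_left_mono log_mono emeasure_mono meas elim) auto
    qed
    then have "liminf (?f (interior \<Gamma>)) \<le> liminf (?f (closure \<Gamma>))" by (rule Liminf_mono)
    also have "\<dots> \<le> limsup (?f (closure \<Gamma>))" by (rule Liminf_le_Limsup) simp
    finally show ?thesis .
  qed
  show "limsup (?f (closure \<Gamma>)) \<le> - (INF x\<in>closure \<Gamma>. I_an \<gamma> x)"
  proof -
    have "(INF x\<in>closure \<Gamma>. I_an \<gamma> x) \<le> - limsup (?f (closure \<Gamma>))"
    proof (rule dense_le)
      fix z assume z: "z < (INF x\<in>closure \<Gamma>. I_an \<gamma> x)"
      show "z \<le> - limsup (?f (closure \<Gamma>))"
      proof (cases z)
        case (real c)
        have "\<forall>\<^sub>F n in sequentially. emeasure (M n) {\<omega> \<in> space (M n). W n \<omega> \<in> closure \<Gamma>} \<le> ennreal (exp (- real n * c))"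
        proof (cases "closure \<Gamma> = {}")
          case False
          \<comment> \<open>Only the point nearest to the origin matters: the closed set lies in
            \<open>{x. |x0| <= |x|}\<close>, and by evenness the rate at \<open>|x0|\<close> is that
            at \<open>x0\<close>, hence at least the infimum. One two-sided tail bound thus covers
            the set, bounded or not.\<close>
          obtain x0 where x0: "x0 \<in> closure \<Gamma>" "infdist 0 (closure \<Gamma>) = dist 0 x0"
            using infdist_attains_inf[OF closed_closure False] by metis
          have le: "\<bar>x0\<bar> \<le> \<bar>x\<bar>" if "x \<in> closure \<Gamma>" for x
            using infdist_le[OF that, of 0] x0(2) by simp
          have "I_an \<gamma> \<bar>x0\<bar> = I_an \<gamma> x0" by (simp add: abs_real_def I_an_even)
          then have "ereal c < I_an \<gamma> \<bar>x0\<bar>"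
            using z real INF_lower[OF x0(1), of "I_an \<gamma>"] by simp
          from upper_bound[OF this abs_ge_zero] eventually_ge_at_top[of 1] show ?thesis
          proof eventually_elim
            case (elim n)
            have [measurable]: "W n \<in> borel_measurable (M n)" by (rule measurable_W[OF elim(2)])
            have "emeasure (M n) {\<omega> \<in> space (M n). W n \<omega> \<in> closure \<Gamma>} \<le> emeasure (M n) {\<omega> \<in> space (M n). \<bar>x0\<bar> \<le> \<bar>W n \<omega>\<bar>}"
              using le by (intro emeasure_mono) auto
            also note elim(1)
            finally show ?case .
          qed
        qed simp
        then have "\<forall>\<^sub>F n in sequentially. ?f (closure \<Gamma>) n \<le> ereal (- c)"
          using eventually_ge_at_top[of 1]
        proof eventually_elim
          case (elim n)
          then have "?f (closure \<Gamma>) n \<le> ereal (1 / real n) * ereal (- real n * c)"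
            by (intro ereal_mult_left_mono) (simp_all only: log_ennreal_le_iff, simp)
          then show ?case using elim(2) by simp
        qed
        then have "limsup (?f (closure \<Gamma>)) \<le> ereal (- c)" by (rule Limsup_bounded)
        then have "- ereal (- c) \<le> - limsup (?f (closure \<Gamma>))" by (simp only: ereal_minus_le_minus)
        then show ?thesis using real by simp
      qed (use z in auto)
    qed
    then have "- (- limsup (?f (closure \<Gamma>))) \<le> - (INF x\<in>closure \<Gamma>. I_an \<gamma> x)"
      by (simp only: ereal_minus_le_minus)
    then show ?thesis by simp
  qed
qed

end

theorem theorem8p1:
  fixes \<gamma> :: "real measure"
    and M :: "nat \<Rightarrow> 'a measure"
    and X \<Theta> :: "nat \<Rightarrow> 'a \<Rightarrow> nat \<Rightarrow> real"
    and W :: "nat \<Rightarrow> 'a \<Rightarrow> real"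
  assumes "prob_space \<gamma>" and "sets \<gamma> = sets borel"
    and "class_T2 \<gamma>"
    and "\<And>n. n \<ge> 1 \<Longrightarrow> prob_space (M n)"
    and "\<And>n. n \<ge> 1 \<Longrightarrow> distr (M n) (Rn n) (X n) = (\<Pi>\<^sub>M i\<in>{1..n}. \<gamma>)"
    and "\<And>n. n \<ge> 1 \<Longrightarrow> uniform_on_sphere n (distr (M n) (Rn n) (\<Theta> n))"
    and "\<And>n. n \<ge> 1 \<Longrightarrow> prob_space.indep_var (M n) (Rn n) (X n) (Rn n) (\<Theta> n)"
    and "\<And>n \<omega>. n \<ge> 1 \<Longrightarrow> \<omega> \<in> space (M n) \<Longrightarrow>
           W n \<omega> = real n powr (-1/2) * (\<Sum>i=1..n. X n \<omega> i * \<Theta> n \<omega> i)"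
  shows "satisfies_LDP M W (\<lambda>n. real n) (I_an \<gamma>)
    \<and> good_rate (I_an \<gamma>) \<and> quasiconvex (I_an \<gamma>)"
proof -
  interpret real_prob \<gamma>
    by (intro real_prob.intro real_prob_axioms.intro assms)
  interpret spherical_projection \<gamma> M X \<Theta> W
    by (rule spherical_projection.intro[OF real_prob_axioms], rule spherical_projection_axioms.intro)
      (rule assms; assumption)+
  show ?thesis using LDP good_I_an[OF assms(3)] quasiconvex_I_an by simp
qed

end
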